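(* Fix a real number $\varepsilon>0$ and let $r=r(n)$ be a natural number such that $2 \le r(n)$ for all $n$ and $r(n) = o(n^{1/3})$ as $n\to\infty$. Let $p=p(n)\in[0,1]$ and let \[ p_c(n,r) = \frac{(r+1) \log{n} - r\log{r}}{\binom{n-1}{r-1}}. \] Then, as $n \to \infty$, \[ \mathbb{P} \left(\alpha (K_p(n,r)) = \binom{n-1}{r-1} \right) \to \begin{cases} 1 &\mbox{if } p \ge (1+\varepsilon)p_c(n,r),\\ 0 &\mbox{if } p \le (1-\varepsilon)p_c(n,r). \end{cases} \] Furthermore, when $p \ge (1+\varepsilon)p_c(n,r)$, with probability tending to $1$ as $n\to\infty$, the only independent sets of size $\binom{n-1}{r-1}$ in $K_p(n,r)$ are stars.
   Context: $[n]=\{1,\dots,n\}$ and $[n]^{(r)}$ denotes the family of all $r$-element subsets of $[n]$. The Kneser graph $K(n,r)$ has vertex set $[n]^{(r)}$, with $A,B$ adjacent iff $A\cap B=\emptyset$. $K_p(n,r)$ denotes the random subgraph of $K(n,r)$ obtained by retaining each edge of $K(n,r)$ independently with probability $p$ (all vertices are kept). $\alpha(G)$ is the independence number of a graph $G$. For $x\in[n]$, the star centred at $x$ is the family of all sets in $[n]^{(r)}$ containing $x$; it has size $\binom{n-1}{r-1}$. $\log$ denotes the natural logarithm. *)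

theory Defs
  imports
    "HOL-Probability.Probability"
    "HOL-Probability.Product_PMF"
    "HOL-Library.Ramsey"
    "HOL-Library.Landau_Symbols"
begin

text \<open>
  A graph is given by its vertex set and its set of edges, an edge being a two-element set of
  vertices; \<^const>\<open>nsets\<close> and \<^const>\<open>indep\<close> come from \<^theory>\<open>HOL-Library.Ramsey\<close>.
\<close>

definition independent_in :: "'a set \<Rightarrow> 'a set set \<Rightarrow> 'a set \<Rightarrow> bool" where
  "independent_in V E S \<longleftrightarrow> S \<subseteq> V \<and> indep S E"

definition independence_number :: "'a set \<Rightarrow> 'a set set \<Rightarrow> nat" where
  "independence_number V E = Max {card S | S. independent_in V E S}"

definition kneser_verts :: "nat \<Rightarrow> nat \<Rightarrow> nat set set" where
  "kneser_verts n r = nsets {1..n} r"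

text \<open>For \<open>r \<ge> 1\<close> disjoint vertices are distinct, so there are no loops.\<close>

definition kneser_edges :: "nat \<Rightarrow> nat \<Rightarrow> nat set set set" where
  "kneser_edges n r =
     {{A, B} | A B. A \<in> kneser_verts n r \<and> B \<in> kneser_verts n r \<and> A \<inter> B = {}}"

definition star_family :: "nat \<Rightarrow> nat \<Rightarrow> nat \<Rightarrow> nat set set" where
  "star_family n r x = {A \<in> kneser_verts n r. x \<in> A}"

text \<open>
  The distribution of the edge set of \<open>K\<^sub>p(n,r)\<close>, whose vertex set is \<^term>\<open>kneser_verts n r\<close>.
  The value \<^term>\<open>False\<close> only fixes the indicator outside the finite set of Kneser edges.
  Meaningful for \<open>0 \<le> p \<le> 1\<close>, as \<^const>\<open>bernoulli_pmf\<close> clamps its parameter.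
\<close>

definition random_kneser_edges :: "nat \<Rightarrow> nat \<Rightarrow> real \<Rightarrow> nat set set set pmf" where
  "random_kneser_edges n r p =
     map_pmf (\<lambda>f. {e \<in> kneser_edges n r. f e})
       (Pi_pmf (kneser_edges n r) False (\<lambda>_. bernoulli_pmf p))"

definition p_crit :: "nat \<Rightarrow> nat \<Rightarrow> real" where
  "p_crit n r =
     ((real r + 1) * ln (real n) - real r * ln (real r)) / real ((n - 1) choose (r - 1))"

end

theory Submission
  imports Defs
    "HOL-Real_Asymp.Real_Asymp"
begin

text \<open>
  Write \<open>N\<close> for the size of a star. Each star is independent, and by Markov's inequality nothing else of
  size \<open>N\<close> is independent above the threshold. Let \<open>S\<close> be a family of \<open>N\<close> sets which is not a star,
  and let \<open>i\<close> be the least number of its members outside a star. If \<open>i\<close> is small, the \<open>i\<close> members of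
  \<open>S\<close> outside the best star must have at most \<open>i\<close> neighbours inside it, although there are about \<open>i N\<close>
  candidate edges; for \<open>i = 1\<close> the expected number of such \<open>S\<close> is about \<open>n (n choose r) exp (- p N)\<close>
  up to smaller factors, which is where \<open>p_crit\<close> comes from. For \<open>i\<close> of order \<open>N\<close> a
  cruder union bound is enough. If no star contains a third of \<open>S\<close>,
  then the degrees \<open>d x\<close> of \<open>S\<close> satisfy \<open>\<Sum> (d x)\<^sup>2 \<le> (1 / 3 + o 1) N\<^sup>2\<close>, so \<open>S\<close> spans about
  \<open>N\<^sup>2 / 3\<close> edges of the Kneser graph; this uses \<open>r\<^sup>3 = o n\<close>.

  Below the threshold, a second moment computation yields a star and a set \<open>A\<close> outside it with no
  edge between them, so that the star together with \<open>A\<close> is independent.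
\<close>

subsection \<open>Kneser graphs and their random subgraphs\<close>

lemma finite_kneser_verts [simp]: "finite (kneser_verts n r)"
  by (simp add: kneser_verts_def finite_imp_finite_nsets)

lemma finite_kneser_edges [simp]: "finite (kneser_edges n r)"
proof (rule finite_subset)
  show "kneser_edges n r \<subseteq> Pow (kneser_verts n r)"
    by (auto simp: kneser_edges_def)
qed simp

lemma kneser_vertsD:
  assumes "A \<in> kneser_verts n r"
  shows "A \<subseteq> {1..n}" "finite A" "card A = r"
  using assms by (auto simp: kneser_verts_def nsets_def)

lemma card_kneser_verts: "card (kneser_verts n r) = n choose r"
  by (simp add: kneser_verts_def)

text \<open>Deleting \<open>Y\<close> is a bijection onto the \<open>(r - card Y)\<close>-subsets of
  \<open>X - Y\<close>. Stars, intersections of two stars and stars avoiding a set are all counted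
  this way.\<close>

lemma card_nsets_superset:
  assumes "finite X" "Y \<subseteq> X" "card Y \<le> r"
  shows "card {A \<in> nsets X r. Y \<subseteq> A} = (card X - card Y) choose (r - card Y)"
proof -
  have fY: "finite Y" using assms finite_subset by blast
  have "bij_betw (\<lambda>A. A - Y) {A \<in> nsets X r. Y \<subseteq> A} (nsets (X - Y) (r - card Y))"
  proof (rule bij_betw_byWitness[where f' = "\<lambda>A. A \<union> Y"])
    show "(\<lambda>A. A \<union> Y) ` nsets (X - Y) (r - card Y) \<subseteq> {A \<in> nsets X r. Y \<subseteq> A}"
    proof
      fix B assume "B \<in> (\<lambda>A. A \<union> Y) ` nsets (X - Y) (r - card Y)"
      then obtain A where A: "A \<subseteq> X - Y" "finite A" "card A = r - card Y" "B = A \<union> Y"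
        by (auto simp: nsets_def)
      then have "card B = r" using assms fY by (subst A(4), subst card_Un_disjoint) auto
      then show "B \<in> {A \<in> nsets X r. Y \<subseteq> A}" using A assms fY by (auto simp: nsets_def)
    qed
  qed (use assms fY in \<open>auto simp: nsets_def card_Diff_subset\<close>)
  then show ?thesis
    using assms fY by (simp add: bij_betw_same_card card_Diff_subset)
qed

lemma card_star:
  assumes "x \<in> {1..n}" "1 \<le> r"
  shows "card (star_family n r x) = (n - 1) choose (r - 1)"
  using card_nsets_superset[of "{1..n}" "{x}" r] assms
  by (simp add: star_family_def kneser_verts_def)

lemma card_star_Int:
  assumes "x \<in> {1..n}" "y \<in> {1..n}" "x \<noteq> y" "2 \<le> r"
  shows "card (star_family n r x \<inter> star_family n r y) = (n - 2) choose (r - 2)"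
proof -
  have "star_family n r x \<inter> star_family n r y = {A \<in> nsets {1..n} r. {x, y} \<subseteq> A}"
    by (auto simp: star_family_def kneser_verts_def)
  then show ?thesis
    using card_nsets_superset[of "{1..n}" "{x, y}" r] assms by (simp add: eval_nat_numeral)
qed

lemma finite_star_family [simp]: "finite (star_family n r x)"
  by (simp add: star_family_def)

text \<open>A member of the star that meets \<open>A\<close> contains some \<open>y \<in> A\<close>,
  and \<open>y \<noteq> x\<close>, so it lies in one of \<open>r\<close> intersections of two stars.
  The additive form avoids subtraction on \<open>nat\<close>.\<close>

lemma card_star_disjoint_ge:
  assumes "x \<in> {1..n}" "2 \<le> r" "A \<in> kneser_verts n r" "x \<notin> A"
  shows "((n - 1) choose (r - 1)) \<le>
    card {C \<in> star_family n r x. A \<inter> C = {}} + r * ((n - 2) choose (r - 2))"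
proof -
  have A: "A \<subseteq> {1..n}" "finite A" "card A = r" using kneser_vertsD assms by auto
  have "star_family n r x \<subseteq> {C \<in> star_family n r x. A \<inter> C = {}} \<union>
      (\<Union>y\<in>A. star_family n r x \<inter> star_family n r y)"
    by (auto simp: star_family_def)
  then have "card (star_family n r x) \<le> card ({C \<in> star_family n r x. A \<inter> C = {}} \<union>
      (\<Union>y\<in>A. star_family n r x \<inter> star_family n r y))"
    using A by (intro card_mono) auto
  also have "\<dots> \<le> card {C \<in> star_family n r x. A \<inter> C = {}} +
      card (\<Union>y\<in>A. star_family n r x \<inter> star_family n r y)"
    by (rule card_Un_le)
  also have "card (\<Union>y\<in>A. star_family n r x \<inter> star_family n r y) \<le>
      (\<Sum>y\<in>A. card (star_family n r x \<inter> star_family n r y))"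
    using A by (intro card_UN_le)
  also have "\<dots> = (\<Sum>y\<in>A. (n - 2) choose (r - 2))"
  proof (rule sum.cong)
    fix y assume "y \<in> A"
    then show "card (star_family n r x \<inter> star_family n r y) = (n - 2) choose (r - 2)"
      using assms A by (intro card_star_Int) auto
  qed simp
  finally show ?thesis using assms A by (simp add: card_star)
qed

text \<open>The event prescribes the states of single edges, so its preimage is a product set and
  its probability factors over the edges.\<close>

lemma prob_random_kneser_edges:
  assumes "0 \<le> p" "p \<le> 1" "F \<subseteq> kneser_edges n r" "G \<subseteq> kneser_edges n r" "F \<inter> G = {}"
  shows "measure_pmf.prob (random_kneser_edges n r p) {E. F \<subseteq> E \<and> G \<inter> E = {}} =
    p ^ card F * (1 - p) ^ card G"
proof -
  let ?K = "kneser_edges n r"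
  let ?P = "Pi_pmf ?K False (\<lambda>_. bernoulli_pmf p)"
  define B where "B e = (if e \<in> F then {True} else if e \<in> G then {False} else UNIV)" for e
  have fin: "finite F" "finite G" using assms finite_subset[OF _ finite_kneser_edges] by auto
  have "(\<lambda>f. {e \<in> ?K. f e}) -` {E. F \<subseteq> E \<and> G \<inter> E = {}} = Pi ?K B"
    using assms by (fastforce simp: B_def Pi_iff disjoint_iff split: if_splits)
  then have "measure_pmf.prob (random_kneser_edges n r p) {E. F \<subseteq> E \<and> G \<inter> E = {}} =
      measure_pmf.prob ?P (Pi ?K B)"
    by (simp add: random_kneser_edges_def)
  also have "\<dots> = (\<Prod>e\<in>?K. measure_pmf.prob (bernoulli_pmf p) (B e))"
    by (rule measure_Pi_pmf_Pi) simp
  also have "\<dots> = (\<Prod>e\<in>?K. (if e \<in> F then p else 1) * (if e \<in> G then 1 - p else 1))"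
    using assms by (intro prod.cong) (auto simp: B_def measure_pmf_single)
  also have "\<dots> = (\<Prod>e\<in>?K. if e \<in> F then p else 1) * (\<Prod>e\<in>?K. if e \<in> G then 1 - p else 1)"
    by (rule prod.distrib)
  also have "(\<Prod>e\<in>?K. if e \<in> F then p else 1) = p ^ card F"
    using assms by (simp add: prod.If_cases Int_absorb1)
  also have "(\<Prod>e\<in>?K. if e \<in> G then 1 - p else 1) = (1 - p) ^ card G"
    using assms by (simp add: prod.If_cases Int_absorb1)
  finally show ?thesis .
qed

text \<open>The random edge set is almost surely a subset of \<open>kneser_edges n r\<close>.
  Deterministic arguments may therefore use that adjacent vertices are disjoint.\<close>

lemma prob_random_kneser_mono:
  assumes "\<And>E. E \<subseteq> kneser_edges n r \<Longrightarrow> E \<in> X \<Longrightarrow> E \<in> Y"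
  shows "measure_pmf.prob (random_kneser_edges n r p) X \<le> measure_pmf.prob (random_kneser_edges n r p) Y"
proof -
  have "set_pmf (random_kneser_edges n r p) \<subseteq> {E. E \<subseteq> kneser_edges n r}"
    by (auto simp: random_kneser_edges_def)
  then have "measure_pmf.prob (random_kneser_edges n r p) X =
      measure_pmf.prob (random_kneser_edges n r p) (X \<inter> {E. E \<subseteq> kneser_edges n r})"
    by (intro measure_prob_cong_0) (auto simp: set_pmf_eq)
  also have "\<dots> \<le> measure_pmf.prob (random_kneser_edges n r p) Y"
    using assms by (intro measure_pmf.finite_measure_mono) auto
  finally show ?thesis .
qed

lemma one_minus_power_le_exp:
  assumes "0 \<le> p" "p \<le> (1::real)" "a \<le> real k"
  shows "(1 - p) ^ k \<le> exp (- p * a)"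
proof -
  have "(1 - p) ^ k \<le> exp (- p) ^ k"
    using assms exp_ge_add_one_self[of "- p"] by (intro power_mono) auto
  also have "\<dots> = exp (- p * k)" by (simp flip: exp_of_nat_mult add: mult.commute)
  also have "\<dots> \<le> exp (- p * a)" using assms by (simp add: mult_left_mono)
  finally show ?thesis .
qed

lemma sum_Pow_power:
  assumes "finite Q"
  shows "(\<Sum>F\<in>Pow Q. (c::real) ^ card F) = (1 + c) ^ card Q"
  using prod_add[of Q "\<lambda>_. c" "\<lambda>_. 1"] assms by (simp add: add.commute)

subsection \<open>Independent sets close to a star\<close>

text \<open>Pairs are ordered, which turns counting into a sum over first components. Within one
  family of nonempty sets every edge is thus counted twice.\<close>

definition disjoint_pairs :: "'a set set \<Rightarrow> 'a set set \<Rightarrow> ('a set \<times> 'a set) set" where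
  "disjoint_pairs \<B> \<U> = {(A, C). A \<in> \<B> \<and> C \<in> \<U> \<and> A \<inter> C = {}}"

definition doubleton :: "'a \<times> 'a \<Rightarrow> 'a set" where
  "doubleton = (\<lambda>(a, c). {a, c})"

lemma finite_disjoint_pairs: "finite \<B> \<Longrightarrow> finite \<U> \<Longrightarrow> finite (disjoint_pairs \<B> \<U>)"
  by (rule finite_subset[of _ "\<B> \<times> \<U>"]) (auto simp: disjoint_pairs_def)

lemma card_disjoint_pairs:
  assumes "finite \<B>" "finite \<U>"
  shows "card (disjoint_pairs \<B> \<U>) = (\<Sum>A\<in>\<B>. card {C \<in> \<U>. A \<inter> C = {}})"
proof -
  have "disjoint_pairs \<B> \<U> = Sigma \<B> (\<lambda>A. {C \<in> \<U>. A \<inter> C = {}})"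
    by (auto simp: disjoint_pairs_def)
  then show ?thesis using assms by simp
qed

text \<open>The centre \<open>x\<close> lies in exactly one member of such a pair, so the unordered
  edge determines the pair.\<close>

lemma inj_on_doubleton:
  assumes "\<And>A. A \<in> \<B> \<Longrightarrow> x \<notin> A" "\<And>C. C \<in> \<U> \<Longrightarrow> x \<in> C"
  shows "inj_on doubleton (disjoint_pairs \<B> \<U>)"
  using assms by (fastforce simp: inj_on_def disjoint_pairs_def doubleton_def doubleton_eq_iff)

lemma doubleton_disjoint_pairs_edges:
  assumes "\<B> \<subseteq> kneser_verts n r" "\<U> \<subseteq> kneser_verts n r"
  shows "doubleton ` disjoint_pairs \<B> \<U> \<subseteq> kneser_edges n r"
  using assms by (auto simp: disjoint_pairs_def kneser_edges_def doubleton_def)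

lemma card_disjoint_pairs_star_ge:
  assumes "x \<in> {1..n}" "2 \<le> r" "\<B> \<subseteq> kneser_verts n r" "\<And>A. A \<in> \<B> \<Longrightarrow> x \<notin> A" "finite T"
  shows "real (card \<B>) * (real ((n - 1) choose (r - 1)) - real r * real ((n - 2) choose (r - 2)) - real (card T))
    \<le> card (disjoint_pairs \<B> (star_family n r x - T))"
proof -
  have finB: "finite \<B>" using assms(3) finite_subset finite_kneser_verts by blast
  have *: "real ((n - 1) choose (r - 1)) - real r * real ((n - 2) choose (r - 2)) - card T
      \<le> card {C \<in> star_family n r x - T. A \<inter> C = {}}" if "A \<in> \<B>" for A
  proof -
    have "{C \<in> star_family n r x. A \<inter> C = {}} \<subseteq> {C \<in> star_family n r x - T. A \<inter> C = {}} \<union> T"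
      by auto
    then have "card {C \<in> star_family n r x. A \<inter> C = {}} \<le> card ({C \<in> star_family n r x - T. A \<inter> C = {}} \<union> T)"
      using assms by (intro card_mono) auto
    also have "\<dots> \<le> card {C \<in> star_family n r x - T. A \<inter> C = {}} + card T"
      by (rule card_Un_le)
    finally have "((n - 1) choose (r - 1)) \<le>
        card {C \<in> star_family n r x - T. A \<inter> C = {}} + card T + r * ((n - 2) choose (r - 2))"
      using card_star_disjoint_ge[of x n r A] assms that by auto
    then have "real ((n - 1) choose (r - 1)) \<le>
        real (card {C \<in> star_family n r x - T. A \<inter> C = {}} + card T + r * ((n - 2) choose (r - 2)))"
      by (simp only: of_nat_le_iff)
    then show ?thesis by simp
  qed
  then have "(\<Sum>A\<in>\<B>. real ((n - 1) choose (r - 1)) - real r * real ((n - 2) choose (r - 2)) - card T)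
      \<le> (\<Sum>A\<in>\<B>. real (card {C \<in> star_family n r x - T. A \<inter> C = {}}))"
    by (rule sum_mono)
  then show ?thesis using finB by (simp add: card_disjoint_pairs)
qed

text \<open>The second components of \<open>F\<close> lie in \<open>T\<close>, so the edges required
  to be present differ from those required to be absent, and the probability is a product.\<close>

lemma prob_cross_edges_le:
  assumes "0 \<le> p" "p \<le> 1" "x \<in> {1..n}" "2 \<le> r"
    and "\<B> \<subseteq> kneser_verts n r" "\<And>A. A \<in> \<B> \<Longrightarrow> x \<notin> A"
    and F: "F \<subseteq> disjoint_pairs \<B> (star_family n r x)"
    and T: "T \<subseteq> star_family n r x" "snd ` F \<subseteq> T"
  shows "measure_pmf.prob (random_kneser_edges n r p)
      {E. doubleton ` F \<subseteq> E \<and> (\<forall>A\<in>\<B>. \<forall>C\<in>star_family n r x - T. {A, C} \<notin> E)}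
    \<le> p ^ card F * exp (- p * (real (card \<B>) *
        (real ((n - 1) choose (r - 1)) - real r * real ((n - 2) choose (r - 2)) - real (card T))))"
proof -
  let ?Q = "disjoint_pairs \<B> (star_family n r x)"
  let ?G = "disjoint_pairs \<B> (star_family n r x - T)"
  have inj: "inj_on doubleton ?Q" using assms by (intro inj_on_doubleton) (auto simp: star_family_def)
  have GQ: "?G \<subseteq> ?Q" by (auto simp: disjoint_pairs_def)
  have FG: "F \<inter> ?G = {}" using T by (force simp: disjoint_pairs_def)
  have dis: "doubleton ` F \<inter> doubleton ` ?G = {}"
    using inj_on_image_Int[OF inj F GQ] FG by auto
  have "measure_pmf.prob (random_kneser_edges n r p)
      {E. doubleton ` F \<subseteq> E \<and> (\<forall>A\<in>\<B>. \<forall>C\<in>star_family n r x - T. {A, C} \<notin> E)} \<le>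
    measure_pmf.prob (random_kneser_edges n r p) {E. doubleton ` F \<subseteq> E \<and> doubleton ` ?G \<inter> E = {}}"
    by (rule measure_pmf.finite_measure_mono) (auto simp: disjoint_pairs_def doubleton_def)
  also have "\<dots> = p ^ card (doubleton ` F) * (1 - p) ^ card (doubleton ` ?G)"
  proof (rule prob_random_kneser_edges)
    have "doubleton ` ?Q \<subseteq> kneser_edges n r"
      using assms by (intro doubleton_disjoint_pairs_edges) (auto simp: star_family_def)
    then show "doubleton ` F \<subseteq> kneser_edges n r" "doubleton ` ?G \<subseteq> kneser_edges n r"
      using F GQ by blast+
  qed (use assms dis in auto)
  also have "card (doubleton ` F) = card F"
    using inj F by (intro card_image) (rule inj_on_subset)
  also have "card (doubleton ` ?G) = card ?G"
    using inj GQ by (intro card_image) (rule inj_on_subset)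
  also have "(1 - p) ^ card ?G \<le> exp (- p * (real (card \<B>) *
        (real ((n - 1) choose (r - 1)) - real r * real ((n - 2) choose (r - 2)) - real (card T))))"
    using assms T finite_subset[OF T(1)]
    by (intro one_minus_power_le_exp card_disjoint_pairs_star_ge) auto
  finally show ?thesis using assms by (simp add: mult_left_mono)
qed

text \<open>
  A union bound over all small sets \<open>T\<close> would cost a factor of about \<open>N\<close> per element of \<open>\<B>\<close>,
  which is too much. Instead the set of neighbours of \<open>\<B>\<close> in the star is witnessed
  by a set \<open>F\<close> of present edges, one for each neighbour.
\<close>

lemma prob_few_neighbours_le:
  fixes \<eta> :: real
  assumes p: "0 \<le> p" "p \<le> 1" and x: "x \<in> {1..n}" and r: "2 \<le> r" and \<eta>: "0 < \<eta>" "\<eta> \<le> 1"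
    and B: "\<B> \<subseteq> kneser_verts n r" "\<And>A. A \<in> \<B> \<Longrightarrow> x \<notin> A"
  shows "measure_pmf.prob (random_kneser_edges n r p)
      {E. \<exists>T\<subseteq>star_family n r x. card T \<le> card \<B> \<and> (\<forall>A\<in>\<B>. \<forall>C\<in>star_family n r x - T. {A, C} \<notin> E)}
    \<le> (1 / \<eta>) ^ card \<B> * exp (p * \<eta> * (card \<B> * ((n - 1) choose (r - 1)))) *
      exp (- p * (real (card \<B>) *
        (real ((n - 1) choose (r - 1)) - real r * real ((n - 2) choose (r - 2)) - real (card \<B>))))"
    (is "measure_pmf.prob ?M ?Ev \<le> _ * _ * ?X")
proof -
  let ?S = "star_family n r x"
  let ?i = "card \<B>"
  let ?Q = "disjoint_pairs \<B> ?S"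
  have finB: "finite \<B>" using B(1) finite_subset finite_kneser_verts by blast
  have finQ: "finite ?Q" using finB by (intro finite_disjoint_pairs) auto
  have cardQ: "card ?Q \<le> ?i * ((n - 1) choose (r - 1))"
  proof -
    have "card ?Q \<le> card (\<B> \<times> ?S)"
      using finB by (intro card_mono) (auto simp: disjoint_pairs_def)
    then show ?thesis using x r by (simp add: card_cartesian_product card_star)
  qed
  define Fs where "Fs = {F. F \<subseteq> ?Q \<and> card F \<le> ?i}"
  have finFs: "finite Fs" using finQ by (simp add: Fs_def)
  define ev where "ev F = {E. doubleton ` F \<subseteq> E \<and> (\<forall>A\<in>\<B>. \<forall>C\<in>?S - snd ` F. {A, C} \<notin> E)}" for F
  have "measure_pmf.prob ?M ?Ev \<le> measure_pmf.prob ?M (\<Union>F\<in>Fs. ev F)"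
  proof (rule prob_random_kneser_mono)
    fix E assume E: "E \<subseteq> kneser_edges n r" and "E \<in> ?Ev"
    then obtain T where T: "T \<subseteq> ?S" "card T \<le> ?i" "\<forall>A\<in>\<B>. \<forall>C\<in>?S - T. {A, C} \<notin> E"
      by auto
    \<comment> \<open>The true neighbourhood of \<open>\<B>\<close> in the star lies inside every
      admissible \<open>T\<close>, so it has at most \<open>card \<B>\<close> elements; one present
      edge per neighbour is the witness.\<close>
    define T' where "T' = {C \<in> ?S. \<exists>A\<in>\<B>. {A, C} \<in> E}"
    have "\<forall>C\<in>T'. \<exists>A. A \<in> \<B> \<and> {A, C} \<in> E" by (auto simp: T'_def)
    then obtain a where a: "\<And>C. C \<in> T' \<Longrightarrow> a C \<in> \<B> \<and> {a C, C} \<in> E" by metis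
    define F where "F = (\<lambda>C. (a C, C)) ` T'"
    have "T' \<subseteq> T" using T by (auto simp: T'_def)
    moreover have "finite T" using T(1) finite_subset finite_star_family by blast
    ultimately have "card T' \<le> ?i" using T card_mono le_trans by blast
    moreover have "finite T'" by (simp add: T'_def)
    ultimately have "card F \<le> ?i" unfolding F_def using card_image_le le_trans by blast
    moreover have "a C \<inter> C = {}" if "C \<in> T'" for C
    proof -
      have "{a C, C} \<in> kneser_edges n r" using a[OF that] E by auto
      then show ?thesis by (auto simp: kneser_edges_def doubleton_eq_iff)
    qed
    then have "F \<subseteq> ?Q" using a by (auto simp: F_def disjoint_pairs_def T'_def)
    moreover have "snd ` F = T'" by (force simp: F_def)
    moreover have "doubleton ` F \<subseteq> E" using a by (auto simp: F_def doubleton_def)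
    ultimately have "F \<in> Fs" "E \<in> ev F" by (auto simp: Fs_def ev_def T'_def)
    then show "E \<in> (\<Union>F\<in>Fs. ev F)" by auto
  qed
  also have "\<dots> \<le> (\<Sum>F\<in>Fs. measure_pmf.prob ?M (ev F))"
    using finFs by (intro measure_pmf.finite_measure_subadditive_finite) auto
  also have "\<dots> \<le> (\<Sum>F\<in>Fs. (1 / \<eta>) ^ ?i * (p * \<eta>) ^ card F * ?X)"
  proof (rule sum_mono)
    fix F assume F: "F \<in> Fs"
    have finF: "finite F" using F finQ finite_subset by (auto simp: Fs_def)
    then have cF: "card (snd ` F) \<le> ?i" "card F \<le> ?i"
      using F card_image_le[of F snd] by (auto simp: Fs_def)
    have "measure_pmf.prob ?M (ev F) \<le> p ^ card F * exp (- p * (real ?i *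
        (real ((n - 1) choose (r - 1)) - real r * real ((n - 2) choose (r - 2)) - real (card (snd ` F)))))"
      unfolding ev_def using F p x r B
      by (intro prob_cross_edges_le) (auto simp: Fs_def disjoint_pairs_def)
    also have "\<dots> \<le> p ^ card F * ?X"
      using cF p by (intro mult_left_mono) (auto intro!: mult_left_mono)
    \<comment> \<open>Trading \<open>p\<close> for \<open>p * \<eta>\<close> costs at most
      \<open>(1 / \<eta>) ^ card \<B>\<close>, since a witness has at most \<open>card \<B>\<close>
      edges. The sum over all witnesses then uses up only a fraction \<open>\<eta>\<close> of the
      main exponent.\<close>
    also have "p ^ card F \<le> (1 / \<eta>) ^ ?i * (p * \<eta>) ^ card F"
    proof -
      have "(1 / \<eta>) ^ card F \<le> (1 / \<eta>) ^ ?i"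
        using \<eta> cF by (intro power_increasing) auto
      then have "(1 / \<eta>) ^ card F * (p * \<eta>) ^ card F \<le> (1 / \<eta>) ^ ?i * (p * \<eta>) ^ card F"
        using p \<eta> by (intro mult_right_mono) auto
      then show ?thesis using \<eta> by (simp flip: power_mult_distrib)
    qed
    finally show "measure_pmf.prob ?M (ev F) \<le> (1 / \<eta>) ^ ?i * (p * \<eta>) ^ card F * ?X"
      by (simp add: mult_right_mono)
  qed
  also have "\<dots> \<le> (\<Sum>F\<in>Pow ?Q. (1 / \<eta>) ^ ?i * (p * \<eta>) ^ card F * ?X)"
    using finQ \<eta> p by (intro sum_mono2) (auto simp: Fs_def)
  also have "\<dots> = (1 / \<eta>) ^ ?i * (1 + p * \<eta>) ^ card ?Q * ?X"
    using finQ by (simp add: sum_Pow_power flip: sum_distrib_left sum_distrib_right)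
  also have "(1 + p * \<eta>) ^ card ?Q \<le> exp (p * \<eta> * (?i * ((n - 1) choose (r - 1))))"
  proof -
    have "(1 + p * \<eta>) ^ card ?Q \<le> exp (p * \<eta>) ^ card ?Q"
      using p \<eta> by (intro power_mono) auto
    also have "\<dots> = exp (p * \<eta> * card ?Q)" by (simp flip: exp_of_nat_mult add: mult.commute)
    also have "\<dots> \<le> exp (p * \<eta> * (?i * ((n - 1) choose (r - 1))))"
      using of_nat_mono[OF cardQ, where 'a = real] p \<eta> by (simp add: mult_left_mono)
    finally show ?thesis .
  qed
  finally show ?thesis using \<eta> by (simp add: mult_left_mono mult_right_mono)
qed

subsection \<open>Independent sets far from all stars\<close>

lemma sum_degrees_eq:
  assumes "finite H" "finite \<S>"
  shows "(\<Sum>x\<in>H. card {A \<in> \<S>. x \<in> A}) = (\<Sum>A\<in>\<S>. card (A \<inter> H))"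
proof -
  have "(\<Sum>x\<in>H. card {A \<in> \<S>. x \<in> A}) = (\<Sum>x\<in>H. \<Sum>A\<in>\<S>. if x \<in> A then 1 else 0)"
    using assms by (simp add: sum.If_cases Int_def)
  also have "\<dots> = (\<Sum>A\<in>\<S>. \<Sum>x\<in>H. if x \<in> A then 1 else 0)"
    by (rule sum.swap)
  also have "\<dots> = (\<Sum>A\<in>\<S>. card (A \<inter> H))"
    using assms by (intro sum.cong) (auto simp: sum.If_cases Int_commute)
  finally show ?thesis .
qed

text \<open>A set that meets \<open>H\<close> in \<open>k\<close> points is counted \<open>k\<close>
  times on the left, and \<open>k \<le> 1 + k * (k - 1)\<close>, where the product counts ordered
  pairs of distinct points of \<open>A \<inter> H\<close>.\<close>

lemma sum_degrees_le_codegrees: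
  assumes "finite H" "finite \<S>"
    and codeg: "\<And>x y. x \<in> H \<Longrightarrow> y \<in> H \<Longrightarrow> x \<noteq> y \<Longrightarrow> card {A \<in> \<S>. x \<in> A \<and> y \<in> A} \<le> D"
  shows "(\<Sum>x\<in>H. card {A \<in> \<S>. x \<in> A}) \<le> card \<S> + (card H)\<^sup>2 * D"
proof -
  have "card (A \<inter> H) \<le> 1 + (\<Sum>x\<in>H. \<Sum>y\<in>H - {x}. if x \<in> A \<and> y \<in> A then 1 else 0)" for A
  proof -
    have "(\<Sum>y\<in>H - {x}. if x \<in> A \<and> y \<in> A then 1 else 0) =
        (if x \<in> A then card (A \<inter> H) - 1 else 0)" if "x \<in> H" for x
    proof (cases "x \<in> A")
      case True
      then have "{y \<in> H - {x}. x \<in> A \<and> y \<in> A} = (A \<inter> H) - {x}" by auto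
      then show ?thesis using True that assms by (simp add: sum.If_cases Int_def)
    qed auto
    then have "(\<Sum>x\<in>H. \<Sum>y\<in>H - {x}. if x \<in> A \<and> y \<in> A then 1 else 0) =
        (\<Sum>x\<in>H. if x \<in> A then card (A \<inter> H) - 1 else 0)" by simp
    also have "\<dots> = card (A \<inter> H) * (card (A \<inter> H) - 1)"
      using assms by (simp add: sum.If_cases Int_commute)
    finally have *: "(\<Sum>x\<in>H. \<Sum>y\<in>H - {x}. if x \<in> A \<and> y \<in> A then 1 else 0) =
        card (A \<inter> H) * (card (A \<inter> H) - 1)" .
    have "k \<le> 1 + k * (k - 1)" for k :: nat by (cases k) auto
    then show ?thesis unfolding * .
  qed
  then have "(\<Sum>A\<in>\<S>. card (A \<inter> H)) \<le>
      (\<Sum>A\<in>\<S>. 1 + (\<Sum>x\<in>H. \<Sum>y\<in>H - {x}. if x \<in> A \<and> y \<in> A then 1 else 0))"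
    by (rule sum_mono)
  also have "\<dots> = card \<S> + (\<Sum>A\<in>\<S>. \<Sum>x\<in>H. \<Sum>y\<in>H - {x}. if x \<in> A \<and> y \<in> A then 1 else 0)"
    by (subst sum.distrib) simp
  also have "(\<Sum>A\<in>\<S>. \<Sum>x\<in>H. \<Sum>y\<in>H - {x}. if x \<in> A \<and> y \<in> A then 1 else (0::nat)) =
      (\<Sum>x\<in>H. \<Sum>A\<in>\<S>. \<Sum>y\<in>H - {x}. if x \<in> A \<and> y \<in> A then 1 else 0)"
    by (rule sum.swap)
  also have "\<dots> = (\<Sum>x\<in>H. \<Sum>y\<in>H - {x}. \<Sum>A\<in>\<S>. if x \<in> A \<and> y \<in> A then 1 else 0)"
    by (intro sum.cong sum.swap refl)
  also have "\<dots> = (\<Sum>x\<in>H. \<Sum>y\<in>H - {x}. card {A \<in> \<S>. x \<in> A \<and> y \<in> A})"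
    using assms by (simp add: sum.If_cases Int_def)
  also have "\<dots> \<le> (\<Sum>x\<in>H. \<Sum>y\<in>H - {x}. D)"
    using codeg by (intro sum_mono) auto
  also have "\<dots> \<le> (card H)\<^sup>2 * D"
    using assms by (simp add: power2_eq_square)
  finally show ?thesis using assms by (simp add: sum_degrees_eq)
qed

text \<open>Two sets that meet share some \<open>x\<close>, so the pair lies in the square of the
  family of members through \<open>x\<close>.\<close>

lemma card_pairs_le_disjoint_pairs:
  assumes "finite X" "finite \<S>" "\<And>A. A \<in> \<S> \<Longrightarrow> A \<subseteq> X"
  shows "(card \<S>)\<^sup>2 \<le> card (disjoint_pairs \<S> \<S>) + (\<Sum>x\<in>X. (card {A \<in> \<S>. x \<in> A})\<^sup>2)"
proof -
  let ?U = "\<lambda>x. {A \<in> \<S>. x \<in> A} \<times> {A \<in> \<S>. x \<in> A}"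
  have "\<S> \<times> \<S> \<subseteq> disjoint_pairs \<S> \<S> \<union> (\<Union>x\<in>X. ?U x)"
    using assms by (fastforce simp: disjoint_pairs_def)
  then have "card (\<S> \<times> \<S>) \<le> card (disjoint_pairs \<S> \<S> \<union> (\<Union>x\<in>X. ?U x))"
    using assms by (intro card_mono) (auto intro: finite_disjoint_pairs)
  also have "\<dots> \<le> card (disjoint_pairs \<S> \<S>) + card (\<Union>x\<in>X. ?U x)"
    by (rule card_Un_le)
  also have "card (\<Union>x\<in>X. ?U x) \<le> (\<Sum>x\<in>X. card (?U x))"
    using assms by (intro card_UN_le)
  finally show ?thesis by (simp add: card_cartesian_product power2_eq_square)
qed

text \<open>
  Let a hub be a point of degree at least \<open>\<eta> N / r\<close>. The other points contribute at most
  \<open>\<eta> N\<^sup>2\<close>. As pairs have small codegree, there are only \<open>O(r / \<eta>)\<close> hubs, and the degrees of these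
  sum to little more than \<open>N\<close>.
\<close>

lemma sum_degrees_squared_le:
  fixes \<eta> :: real
  assumes fin: "finite X" "finite \<S>" and SX: "\<And>A. A \<in> \<S> \<Longrightarrow> A \<subseteq> X \<and> card A = r"
    and r: "1 \<le> r" and \<eta>: "0 < \<eta>" "\<eta> \<le> 1" and N: "0 < card \<S>"
    and codeg: "\<And>x y. x \<in> X \<Longrightarrow> y \<in> X \<Longrightarrow> x \<noteq> y \<Longrightarrow> card {A \<in> \<S>. x \<in> A \<and> y \<in> A} \<le> D"
    and deg: "\<And>x. x \<in> X \<Longrightarrow> 3 * card {A \<in> \<S>. x \<in> A} \<le> card \<S>"
    and D: "9 * (real r)\<^sup>2 * D < \<eta> ^ 3 * card \<S>"
  shows "(\<Sum>x\<in>X. (real (card {A \<in> \<S>. x \<in> A}))\<^sup>2) \<le> (card \<S>)\<^sup>2 * (1 / 3 + 2 * \<eta>)"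
proof -
  define d where "d x = real (card {A \<in> \<S>. x \<in> A})" for x
  define N where "N = real (card \<S>)"
  define H where "H = {x \<in> X. \<eta> * N / r \<le> d x}"
  have Npos: "N > 0" using N by (simp add: N_def)
  have finH: "finite H" using fin by (simp add: H_def)
  have sum_le: "(\<Sum>x\<in>H'. d x) \<le> N + (card H')\<^sup>2 * D" if "H' \<subseteq> H" for H'
  proof -
    have "(\<Sum>x\<in>H'. card {A \<in> \<S>. x \<in> A}) \<le> card \<S> + (card H')\<^sup>2 * D"
      using that fin finite_subset[OF that finH]
      by (intro sum_degrees_le_codegrees codeg) (auto simp: H_def)
    then have "real (\<Sum>x\<in>H'. card {A \<in> \<S>. x \<in> A}) \<le> real (card \<S> + (card H')\<^sup>2 * D)"
      by (simp only: of_nat_le_iff)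
    then show ?thesis by (simp add: d_def N_def)
  qed
  \<comment> \<open>The smallness of \<open>D\<close> enters here: for up to
    \<open>3 * r / \<eta>\<close> hubs the overlap term stays below
    \<open>\<eta> * N\<close>.\<close>
  have small: "real k ^ 2 * D < \<eta> * N" if "real k \<le> 3 * r / \<eta>" for k
  proof -
    have "real k ^ 2 * D \<le> (3 * r / \<eta>) ^ 2 * D"
      using that by (intro mult_right_mono power_mono) auto
    also have "\<dots> = (9 * (real r)\<^sup>2 * D) / \<eta> ^ 2" by (simp add: power2_eq_square)
    also have "\<dots> < (\<eta> ^ 3 * N) / \<eta> ^ 2"
      using D \<eta> by (intro divide_strict_right_mono) (auto simp: N_def)
    also have "\<dots> = \<eta> * N" using \<eta> by (simp add: power2_eq_square power3_eq_cube)
    finally show ?thesis .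
  qed
  have cardH: "real (card H) \<le> 3 * r / \<eta>"
  proof (rule ccontr)
    \<comment> \<open>With too many hubs, pick about \<open>2 * r / \<eta>\<close> of them. Their
      degrees add up to at least \<open>2 * N\<close>, but the overlap bound allows less than
      \<open>(1 + \<eta>) * N\<close>. Rounding up stays within \<open>3 * r / \<eta>\<close>
      because \<open>r / \<eta> \<ge> 1\<close>.\<close>
    define m where "m = nat \<lceil>2 * r / \<eta>\<rceil>"
    have m1: "real m < 2 * r / \<eta> + 1" "real m \<ge> 2 * r / \<eta>"
      using r \<eta> unfolding m_def by (auto simp: of_nat_nat intro: ceiling_correct) linarith+
    have "1 \<le> r / \<eta>" using r \<eta> by (simp add: field_simps)
    moreover have "3 * r / \<eta> = 2 * r / \<eta> + r / \<eta>" by (simp add: field_simps)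
    ultimately have m2: "real m \<le> 3 * r / \<eta>" using m1 by linarith
    assume "\<not> real (card H) \<le> 3 * r / \<eta>"
    then have "m \<le> card H" using m2 by linarith
    then obtain H' where H': "H' \<subseteq> H" "card H' = m" "finite H'"
      using obtain_subset_with_card_n by metis
    have "2 * N = (2 * r / \<eta>) * (\<eta> * N / r)" using r \<eta> by simp
    also have "\<dots> \<le> m * (\<eta> * N / r)" using m1 \<eta> Npos by (intro mult_right_mono) auto
    also have "\<dots> = (\<Sum>x\<in>H'. \<eta> * N / r)" using H' by simp
    also have "\<dots> \<le> (\<Sum>x\<in>H'. d x)" using H' by (intro sum_mono) (auto simp: H_def)
    also have "\<dots> \<le> N + (real m)\<^sup>2 * D" using sum_le[OF H'(1)] H' by simp
    also have "\<dots> < N + \<eta> * N" using small[OF m2] by simp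
    also have "\<dots> \<le> 2 * N" using \<eta> Npos by simp
    finally show False by simp
  qed
  have dnn: "d x \<ge> 0" for x by (simp add: d_def)
  have "d x \<le> N / 3" if "x \<in> X" for x
    using of_nat_mono[OF deg[OF that], where 'a = real] by (simp add: d_def N_def)
  then have "(\<Sum>x\<in>H. (d x)\<^sup>2) \<le> (\<Sum>x\<in>H. N / 3 * d x)"
    unfolding power2_eq_square using dnn by (intro sum_mono mult_right_mono) (auto simp: H_def)
  also have "\<dots> = N / 3 * (\<Sum>x\<in>H. d x)" by (simp add: sum_distrib_left)
  also have "\<dots> \<le> N / 3 * (N + \<eta> * N)"
    using sum_le[of H] small[OF cardH] Npos by (intro mult_left_mono) auto
  finally have 1: "(\<Sum>x\<in>H. (d x)\<^sup>2) \<le> N\<^sup>2 * (1 / 3 + \<eta> / 3)"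
    by (simp add: power2_eq_square algebra_simps)
  \<comment> \<open>Off the hubs one factor of each square is below \<open>\<eta> * N / r\<close>,
    and all degrees together add up to \<open>r * N\<close>.\<close>
  have "(\<Sum>x\<in>X - H. (d x)\<^sup>2) \<le> (\<Sum>x\<in>X - H. \<eta> * N / r * d x)"
    unfolding power2_eq_square using dnn by (intro sum_mono mult_right_mono) (auto simp: H_def)
  also have "\<dots> = \<eta> * N / r * (\<Sum>x\<in>X - H. d x)" by (simp add: sum_distrib_left)
  also have "\<dots> \<le> \<eta> * N / r * (\<Sum>x\<in>X. d x)"
    using fin dnn \<eta> Npos by (intro mult_left_mono sum_mono2) auto
  also have "(\<Sum>x\<in>X. d x) = real (\<Sum>A\<in>\<S>. card (A \<inter> X))"
    unfolding d_def sum_degrees_eq[OF fin, symmetric] by simp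
  also have "(\<Sum>A\<in>\<S>. card (A \<inter> X)) = (\<Sum>A\<in>\<S>. r)"
    using SX by (intro sum.cong) (auto simp: Int_absorb2)
  also have "\<eta> * N / r * real (\<Sum>A\<in>\<S>. r) = N\<^sup>2 * \<eta>"
    using r by (simp add: N_def power2_eq_square)
  finally have 2: "(\<Sum>x\<in>X - H. (d x)\<^sup>2) \<le> N\<^sup>2 * \<eta>" .
  have "(\<Sum>x\<in>X. (d x)\<^sup>2) = (\<Sum>x\<in>X - H. (d x)\<^sup>2) + (\<Sum>x\<in>H. (d x)\<^sup>2)"
    using fin by (intro sum.subset_diff) (auto simp: H_def)
  also have "\<dots> \<le> N\<^sup>2 * \<eta> + N\<^sup>2 * (1 / 3 + \<eta> / 3)" using 1 2 by (rule add_mono[rotated])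
  also have "\<dots> \<le> N\<^sup>2 * (1 / 3 + 2 * \<eta>)" using \<eta> by (simp add: algebra_simps)
  finally show ?thesis by (simp add: d_def N_def)
qed

lemma card_le_twice_doubleton:
  assumes "finite P"
  shows "card P \<le> 2 * card (doubleton ` P)"
proof -
  have "card P = (\<Sum>e\<in>doubleton ` P. card {q \<in> P. doubleton q = e})"
    unfolding card_eq_sum by (rule sum.image_gen[OF assms])
  also have "\<dots> \<le> (\<Sum>e\<in>doubleton ` P. 2)"
  proof (rule sum_mono)
    fix e assume "e \<in> doubleton ` P"
    then obtain q where e: "e = doubleton q" by blast
    obtain a c where q: "q = (a, c)" by (cases q)
    have "z = (a, c) \<or> z = (c, a)" if "doubleton z = doubleton (a, c)" for z
      using that by (cases z) (simp add: doubleton_def doubleton_eq_iff)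
    then have "{q \<in> P. doubleton q = e} \<subseteq> {(a, c), (c, a)}"
      unfolding e q by blast
    then have "card {q \<in> P. doubleton q = e} \<le> card {(a, c), (c, a)}"
      by (intro card_mono) auto
    also have "\<dots> \<le> 2" using card_length[of "[(a, c), (c, a)]"] by simp
    finally show "card {q \<in> P. doubleton q = e} \<le> 2" .
  qed
  finally show ?thesis by simp
qed

text \<open>All edges inside \<open>\<S>\<close> must be absent; the factor 2 in the hypothesis
  converts ordered pairs into edges.\<close>

lemma prob_indep_le:
  fixes a :: real
  assumes "0 \<le> p" "p \<le> 1" "1 \<le> r" "\<S> \<subseteq> kneser_verts n r" "2 * a \<le> card (disjoint_pairs \<S> \<S>)"
  shows "measure_pmf.prob (random_kneser_edges n r p) {E. indep \<S> E} \<le> exp (- p * a)"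
proof -
  let ?G = "doubleton ` disjoint_pairs \<S> \<S>"
  have finS: "finite \<S>" using assms(4) finite_subset finite_kneser_verts by blast
  have "measure_pmf.prob (random_kneser_edges n r p) {E. indep \<S> E} \<le>
      measure_pmf.prob (random_kneser_edges n r p) {E. {} \<subseteq> E \<and> ?G \<inter> E = {}}"
  proof (rule measure_pmf.finite_measure_mono)
    \<comment> \<open>Disjoint nonempty sets are distinct, and \<open>indep\<close> speaks only
      about distinct vertices.\<close>
    have "A \<noteq> C" if "A \<in> \<S>" "A \<inter> C = {}" for A C
      using that assms kneser_vertsD(3)[of A n r] by auto
    then show "{E. indep \<S> E} \<subseteq> {E. {} \<subseteq> E \<and> ?G \<inter> E = {}}"
      by (fastforce simp: indep_def disjoint_pairs_def doubleton_def)
  qed simp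
  also have "\<dots> = p ^ card ({} :: nat set set set) * (1 - p) ^ card ?G"
    using assms by (intro prob_random_kneser_edges doubleton_disjoint_pairs_edges) auto
  also have "\<dots> \<le> exp (- p * a)"
  proof -
    have "card (disjoint_pairs \<S> \<S>) \<le> 2 * card ?G"
      using finS by (intro card_le_twice_doubleton finite_disjoint_pairs)
    then have "a \<le> real (card ?G)" using assms by linarith
    then show ?thesis using one_minus_power_le_exp[of p a "card ?G"] assms by simp
  qed
  finally show ?thesis .
qed

text \<open>At most a fraction \<open>1 / 3 + 2 * \<eta>\<close> of the ordered pairs meet. The
  remaining \<open>2 / 3 - 2 * \<eta>\<close> are disjoint, and halving gives
  \<open>1 / 3 - \<eta>\<close>.\<close>

lemma prob_indep_small_degrees_le:
  fixes \<eta> :: real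
  assumes "0 \<le> p" "p \<le> 1" "2 \<le> r" "\<S> \<subseteq> kneser_verts n r" "0 < \<eta>" "\<eta> \<le> 1" "0 < card \<S>"
    and deg: "\<And>x. x \<in> {1..n} \<Longrightarrow> 3 * card (\<S> \<inter> star_family n r x) \<le> card \<S>"
    and D: "9 * (real r)\<^sup>2 * ((n - 2) choose (r - 2)) < \<eta> ^ 3 * card \<S>"
  shows "measure_pmf.prob (random_kneser_edges n r p) {E. indep \<S> E}
    \<le> exp (- p * ((card \<S>)\<^sup>2 * (1 / 3 - \<eta>)))"
proof (rule prob_indep_le)
  have finS: "finite \<S>" using assms(4) finite_subset finite_kneser_verts by blast
  have "(card \<S>)\<^sup>2 \<le> card (disjoint_pairs \<S> \<S>) + (\<Sum>x\<in>{1..n}. (card {A \<in> \<S>. x \<in> A})\<^sup>2)"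
    using finS assms kneser_vertsD(1) by (intro card_pairs_le_disjoint_pairs) blast+
  then have "real ((card \<S>)\<^sup>2) \<le>
      real (card (disjoint_pairs \<S> \<S>) + (\<Sum>x\<in>{1..n}. (card {A \<in> \<S>. x \<in> A})\<^sup>2))"
    by (simp only: of_nat_le_iff)
  moreover have "(\<Sum>x\<in>{1..n}. (real (card {A \<in> \<S>. x \<in> A}))\<^sup>2) \<le> (card \<S>)\<^sup>2 * (1 / 3 + 2 * \<eta>)"
  proof (rule sum_degrees_squared_le[where r = r and D = "(n - 2) choose (r - 2)"])
    fix x y assume xy: "x \<in> {1..n}" "y \<in> {1..n}" "x \<noteq> y"
    have "card {A \<in> \<S>. x \<in> A \<and> y \<in> A} \<le> card (star_family n r x \<inter> star_family n r y)"
      using assms by (intro card_mono) (auto simp: star_family_def)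
    then show "card {A \<in> \<S>. x \<in> A \<and> y \<in> A} \<le> (n - 2) choose (r - 2)"
      using xy assms by (simp add: card_star_Int)
  next
    fix x assume x: "x \<in> {1..n}"
    have "{A \<in> \<S>. x \<in> A} = \<S> \<inter> star_family n r x"
      using assms by (auto simp: star_family_def)
    then show "3 * card {A \<in> \<S>. x \<in> A} \<le> card \<S>" using deg[OF x] by simp
  next
    fix A assume "A \<in> \<S>"
    then show "A \<subseteq> {1..n} \<and> card A = r"
      using assms(4) kneser_vertsD(1,3)[of A n r] by (simp add: subset_iff)
  qed (use assms(3,5-7) D finS in simp_all)
  ultimately show "2 * ((card \<S>)\<^sup>2 * (1 / 3 - \<eta>)) \<le> card (disjoint_pairs \<S> \<S>)"
    by (simp add: algebra_simps)
qed (use assms(1-4) in simp_all)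

section \<open>Union bounds according to the distance from a star\<close>

lemma prob_UN_le:
  assumes "finite I" "\<And>i. i \<in> I \<Longrightarrow> measure_pmf.prob M (X i) \<le> c" "real (card I) \<le> k" "0 \<le> c"
  shows "measure_pmf.prob M (\<Union>i\<in>I. X i) \<le> k * c"
proof -
  have "measure_pmf.prob M (\<Union>i\<in>I. X i) \<le> (\<Sum>i\<in>I. measure_pmf.prob M (X i))"
    using assms by (intro measure_pmf.finite_measure_subadditive_finite) auto
  also have "\<dots> \<le> (\<Sum>i\<in>I. c)" using assms by (intro sum_mono) auto
  also have "\<dots> \<le> k * c" using assms by (simp add: mult_right_mono)
  finally show ?thesis .
qed

lemma card_subsets_le:
  assumes "finite K" "K' \<subseteq> K"
  shows "real (card {B. B \<subseteq> K' \<and> card B = i}) \<le> real (card K choose i)"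
proof -
  have "card {B. B \<subseteq> K' \<and> card B = i} \<le> card {B. B \<subseteq> K \<and> card B = i}"
    using assms by (intro card_mono) auto
  then show ?thesis using assms by (simp add: n_subsets)
qed

context
  fixes n r N D :: nat and p \<eta> :: real
  assumes p: "0 \<le> p" "p \<le> 1" and r: "2 \<le> r" and \<eta>: "0 < \<eta>" "\<eta> \<le> 1"
    and N: "N = (n - 1) choose (r - 1)" "0 < N" and D: "D = (n - 2) choose (r - 2)"
    and DN: "9 * (real r)\<^sup>2 * D < \<eta> ^ 3 * N"
begin

text \<open>\<open>DN\<close> is the form in which r^3 = o(n) enters, as \<open>D / N\<close> equals
  \<open>(r - 1) / (n - 1)\<close>. This weaker consequence absorbs the members of a star that meet
  a given outside set.\<close>

private lemma rD_le: "real r * D \<le> \<eta> * N"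
proof -
  have "real r * D \<le> 9 * (real r)\<^sup>2 * D"
    using r by (intro mult_right_mono) (auto simp: power2_eq_square)
  also have "\<dots> \<le> \<eta> ^ 3 * N" using DN by simp
  also have "\<dots> \<le> \<eta> * N" using \<eta> power_decreasing[of 1 3 \<eta>] by (intro mult_right_mono) auto
  finally show ?thesis .
qed

text \<open>Three losses of at most \<open>\<eta> * N\<close> each lead to
  \<open>1 - 3 * \<eta>\<close>: the star members meeting a given \<open>A\<close>, the members of
  \<open>T\<close>, and the sum over witnesses.\<close>

lemma prob_near_star_le:
  assumes x: "x \<in> {1..n}" and i: "real i \<le> \<eta> * N"
  shows "measure_pmf.prob (random_kneser_edges n r p)
      {E. \<exists>\<B>\<subseteq>kneser_verts n r - star_family n r x. card \<B> = i \<and>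
        (\<exists>T\<subseteq>star_family n r x. card T \<le> i \<and> (\<forall>A\<in>\<B>. \<forall>C\<in>star_family n r x - T. {A, C} \<notin> E))}
    \<le> ((n choose r) choose i) * ((1 / \<eta>) ^ i * exp (- p * (i * (N * (1 - 3 * \<eta>)))))"
proof -
  define Bs where "Bs = {\<B>. \<B> \<subseteq> kneser_verts n r - star_family n r x \<and> card \<B> = i}"
  define ev where "ev \<B> = {E. \<exists>T\<subseteq>star_family n r x. card T \<le> card \<B> \<and>
      (\<forall>A\<in>\<B>. \<forall>C\<in>star_family n r x - T. {A, C} \<notin> E)}" for \<B>
  have "{E. \<exists>\<B>\<subseteq>kneser_verts n r - star_family n r x. card \<B> = i \<and>
        (\<exists>T\<subseteq>star_family n r x. card T \<le> i \<and> (\<forall>A\<in>\<B>. \<forall>C\<in>star_family n r x - T. {A, C} \<notin> E))}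
      = (\<Union>\<B>\<in>Bs. ev \<B>)"
    by (auto simp: Bs_def ev_def)
  moreover have "measure_pmf.prob (random_kneser_edges n r p) (\<Union>\<B>\<in>Bs. ev \<B>)
      \<le> ((n choose r) choose i) * ((1 / \<eta>) ^ i * exp (- p * (i * (N * (1 - 3 * \<eta>)))))"
  proof (rule prob_UN_le)
    show "finite Bs" by (simp add: Bs_def)
    show "real (card Bs) \<le> real ((n choose r) choose i)"
      using card_subsets_le[of "kneser_verts n r"] by (simp add: Bs_def card_kneser_verts)
    fix \<B> assume "\<B> \<in> Bs"
    then have B: "\<B> \<subseteq> kneser_verts n r" "\<And>A. A \<in> \<B> \<Longrightarrow> x \<notin> A" "card \<B> = i"
      by (auto simp: Bs_def star_family_def)
    have "measure_pmf.prob (random_kneser_edges n r p) (ev \<B>) \<le>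
        (1 / \<eta>) ^ i * exp (p * \<eta> * (i * N)) * exp (- p * (real i * (real N - real r * D - real i)))"
      using prob_few_neighbours_le[OF p x r \<eta> B(1,2)] B(3) by (simp add: ev_def N D)
    also have "\<dots> = (1 / \<eta>) ^ i * exp (- p * (i * (real N - real r * D - real i - \<eta> * N)))"
      by (simp add: algebra_simps flip: exp_add)
    also have "\<dots> \<le> (1 / \<eta>) ^ i * exp (- p * (i * (N * (1 - 3 * \<eta>))))"
    proof -
      have "N * (1 - 3 * \<eta>) \<le> real N - real r * D - real i - \<eta> * N"
        using rD_le i by (simp add: algebra_simps)
      then have "p * (i * (N * (1 - 3 * \<eta>))) \<le> p * (i * (real N - real r * D - real i - \<eta> * N))"
        using p by (intro mult_left_mono) auto
      then show ?thesis using \<eta> by (intro mult_left_mono) auto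
    qed
    finally show "measure_pmf.prob (random_kneser_edges n r p) (ev \<B>) \<le>
      (1 / \<eta>) ^ i * exp (- p * (i * (N * (1 - 3 * \<eta>))))" .
  qed (use \<eta> in simp)
  ultimately show ?thesis by simp
qed

text \<open>This is meant for \<open>i\<close> of order \<open>N\<close>, where choosing
  \<open>T\<close> costs only a constant factor per element and no witnesses are needed. Removing
  \<open>T\<close> still leaves a third of the star.\<close>

lemma prob_mid_star_le:
  assumes x: "x \<in> {1..n}" and i: "3 * i \<le> 2 * N"
  shows "measure_pmf.prob (random_kneser_edges n r p)
      {E. \<exists>\<B>\<subseteq>kneser_verts n r - star_family n r x. card \<B> = i \<and>
        (\<exists>T\<subseteq>star_family n r x. card T = i \<and> (\<forall>A\<in>\<B>. \<forall>C\<in>star_family n r x - T. {A, C} \<notin> E))}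
    \<le> ((n choose r) choose i) * ((N choose i) * exp (- p * (i * (N * (1 / 3 - \<eta>)))))"
proof -
  define Bs where "Bs = {\<B>. \<B> \<subseteq> kneser_verts n r - star_family n r x \<and> card \<B> = i}"
  define Ts where "Ts = {T. T \<subseteq> star_family n r x \<and> card T = i}"
  define ev where "ev \<B> T = {E. \<forall>A\<in>\<B>. \<forall>C\<in>star_family n r x - T. {A, C} \<notin> E}" for \<B> T
  have "{E. \<exists>\<B>\<subseteq>kneser_verts n r - star_family n r x. card \<B> = i \<and>
        (\<exists>T\<subseteq>star_family n r x. card T = i \<and> (\<forall>A\<in>\<B>. \<forall>C\<in>star_family n r x - T. {A, C} \<notin> E))}
      = (\<Union>\<B>\<in>Bs. \<Union>T\<in>Ts. ev \<B> T)"
    by (auto simp: Bs_def Ts_def ev_def)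
  moreover have "measure_pmf.prob (random_kneser_edges n r p) (\<Union>\<B>\<in>Bs. \<Union>T\<in>Ts. ev \<B> T)
      \<le> ((n choose r) choose i) * ((N choose i) * exp (- p * (i * (N * (1 / 3 - \<eta>)))))"
  proof (intro prob_UN_le)
    show "finite Bs" "finite Ts" by (simp_all add: Bs_def Ts_def)
    show "real (card Bs) \<le> real ((n choose r) choose i)"
      using card_subsets_le[of "kneser_verts n r"] by (simp add: Bs_def card_kneser_verts)
    show "real (card Ts) \<le> real (N choose i)"
      using x r by (simp add: Ts_def n_subsets card_star N)
    fix \<B> T assume "\<B> \<in> Bs" and T: "T \<in> Ts"
    then have B: "\<B> \<subseteq> kneser_verts n r" "\<And>A. A \<in> \<B> \<Longrightarrow> x \<notin> A" "card \<B> = i"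
      by (auto simp: Bs_def star_family_def)
    have "measure_pmf.prob (random_kneser_edges n r p) (ev \<B> T) \<le>
        exp (- p * (real i * (real N - real r * D - real i)))"
      using prob_cross_edges_le[OF p x r B(1,2), of "{}" T] B(3) T by (simp add: ev_def N D Ts_def)
    also have "\<dots> \<le> exp (- p * (i * (N * (1 / 3 - \<eta>))))"
    proof -
      have "3 * real i \<le> 2 * real N" using i by linarith
      then have "N * (1 / 3 - \<eta>) \<le> real N - real r * D - real i"
        using rD_le by (simp add: algebra_simps)
      then have "p * (i * (N * (1 / 3 - \<eta>))) \<le> p * (i * (real N - real r * D - real i))"
        using p by (intro mult_left_mono) auto
      then show ?thesis by simp
    qed
    finally show "measure_pmf.prob (random_kneser_edges n r p) (ev \<B> T) \<le>
      exp (- p * (i * (N * (1 / 3 - \<eta>))))" .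
  qed simp_all
  ultimately show ?thesis by simp
qed

lemma prob_far_from_stars_le:
  "measure_pmf.prob (random_kneser_edges n r p)
      {E. \<exists>\<S>\<subseteq>kneser_verts n r. card \<S> = N \<and> indep \<S> E \<and>
         (\<forall>x\<in>{1..n}. 3 * card (\<S> \<inter> star_family n r x) \<le> N)}
    \<le> ((n choose r) choose N) * exp (- p * ((real N)\<^sup>2 * (1 / 3 - \<eta>)))"
proof -
  define Ss where "Ss = {\<S>. \<S> \<subseteq> kneser_verts n r \<and> card \<S> = N \<and>
      (\<forall>x\<in>{1..n}. 3 * card (\<S> \<inter> star_family n r x) \<le> N)}"
  have "{E. \<exists>\<S>\<subseteq>kneser_verts n r. card \<S> = N \<and> indep \<S> E \<and>
         (\<forall>x\<in>{1..n}. 3 * card (\<S> \<inter> star_family n r x) \<le> N)} = (\<Union>\<S>\<in>Ss. {E. indep \<S> E})"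
    by (auto simp: Ss_def)
  moreover have "measure_pmf.prob (random_kneser_edges n r p) (\<Union>\<S>\<in>Ss. {E. indep \<S> E})
    \<le> ((n choose r) choose N) * exp (- p * ((real N)\<^sup>2 * (1 / 3 - \<eta>)))"
  proof (rule prob_UN_le)
    show "finite Ss" by (simp add: Ss_def)
    have "card Ss \<le> card {\<S>. \<S> \<subseteq> kneser_verts n r \<and> card \<S> = N}"
      by (intro card_mono) (auto simp: Ss_def)
    then show "real (card Ss) \<le> real ((n choose r) choose N)"
      by (simp add: n_subsets card_kneser_verts)
    fix \<S> assume "\<S> \<in> Ss"
    then show "measure_pmf.prob (random_kneser_edges n r p) {E. indep \<S> E}
        \<le> exp (- p * ((real N)\<^sup>2 * (1 / 3 - \<eta>)))"
      using prob_indep_small_degrees_le[of p r \<S> n \<eta>] p r \<eta> N DN D by (auto simp: Ss_def)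
  qed simp
  ultimately show ?thesis by simp
qed

text \<open>The three summands sort \<open>\<S>\<close> by the number \<open>i\<close> of its
  members outside a star that it meets most. The factor \<open>n\<close> pays for the choice of the
  centre.\<close>

lemma prob_nonstar_indep_le:
  "measure_pmf.prob (random_kneser_edges n r p)
      {E. \<exists>\<S>. independent_in (kneser_verts n r) E \<S> \<and> card \<S> = N \<and>
        (\<forall>x\<in>{1..n}. \<S> \<noteq> star_family n r x)}
    \<le> (\<Sum>i | 1 \<le> i \<and> real i \<le> \<eta> * N.
          n * (((n choose r) choose i) * ((1 / \<eta>) ^ i * exp (- p * (i * (N * (1 - 3 * \<eta>)))))))
      + (\<Sum>i | \<eta> * N < real i \<and> 3 * i \<le> 2 * N.
          n * (((n choose r) choose i) * ((N choose i) * exp (- p * (i * (N * (1 / 3 - \<eta>)))))))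
      + ((n choose r) choose N) * exp (- p * ((real N)\<^sup>2 * (1 / 3 - \<eta>)))"
  (is "measure_pmf.prob ?M ?Bad \<le> sum ?f1 ?I1 + sum ?f2 ?I2 + ?c")
proof -
  let ?K = "kneser_verts n r" and ?st = "star_family n r"
  define near where "near i x = {E. \<exists>\<B>\<subseteq>?K - ?st x. card \<B> = i \<and>
      (\<exists>T\<subseteq>?st x. card T \<le> i \<and> (\<forall>A\<in>\<B>. \<forall>C\<in>?st x - T. {A, C} \<notin> E))}" for i x
  define mid where "mid i x = {E. \<exists>\<B>\<subseteq>?K - ?st x. card \<B> = i \<and>
      (\<exists>T\<subseteq>?st x. card T = i \<and> (\<forall>A\<in>\<B>. \<forall>C\<in>?st x - T. {A, C} \<notin> E))}" for i x
  define far where "far = {E. \<exists>\<S>\<subseteq>?K. card \<S> = N \<and> indep \<S> E \<and>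
         (\<forall>x\<in>{1..n}. 3 * card (\<S> \<inter> ?st x) \<le> N)}"
  let ?U1 = "\<Union>i\<in>?I1. \<Union>x\<in>{1..n}. near i x" and ?U2 = "\<Union>i\<in>?I2. \<Union>x\<in>{1..n}. mid i x"
  have fin: "finite ?I1" "finite ?I2"
  proof -
    have "?I1 \<subseteq> {..nat \<lceil>\<eta> * N\<rceil>}" using \<eta> by (auto simp: le_nat_iff) linarith
    then show "finite ?I1" by (rule finite_subset) simp
    have "?I2 \<subseteq> {..N}" by auto
    then show "finite ?I2" by (rule finite_subset) simp
  qed
  have n: "{1..n} \<noteq> {}" using N r by (cases n) auto
  have "?Bad \<subseteq> ?U1 \<union> ?U2 \<union> far"
  proof
    fix E assume "E \<in> ?Bad"
    then obtain \<S> where S: "\<S> \<subseteq> ?K" "indep \<S> E" "card \<S> = N" "\<And>x. x \<in> {1..n} \<Longrightarrow> \<S> \<noteq> ?st x"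
      by (auto simp: independent_in_def)
    have finS: "finite \<S>" using S(3) N card.infinite by fastforce
    define d where "d x = card (\<S> \<inter> ?st x)" for x
    have "Max (d ` {1..n}) \<in> d ` {1..n}" using n by (intro Max_in) auto
    then obtain x where x: "x \<in> {1..n}" "d x = Max (d ` {1..n})" by auto
    have dx: "d y \<le> d x" if "y \<in> {1..n}" for y unfolding x(2) using that by (intro Max_ge) auto
    \<comment> \<open>Since \<open>\<S>\<close> and the star both have \<open>N\<close> members,
      \<open>\<B>\<close> and \<open>T\<close> have the same size.\<close>
    define \<B> T where "\<B> = \<S> - ?st x" and "T = ?st x - \<S>"
    define i where "i = card \<B>"
    have cst: "card (?st x) = N" using x r N by (simp add: card_star)
    have "card \<S> = d x + i"
      unfolding d_def i_def \<B>_def using finS by (metis card_Int_Diff)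
    moreover have "card (?st x) = d x + card T"
      unfolding d_def T_def by (metis card_Int_Diff finite_star_family Int_commute)
    ultimately have iT: "card T = i" "N = d x + i" using S cst by auto
    have "i \<noteq> 0"
    proof
      assume "i = 0"
      then have "\<S> \<subseteq> ?st x" using finS by (auto simp: i_def \<B>_def)
      then have "\<S> = ?st x" using S cst by (intro card_subset_eq) auto
      then show False using S x by auto
    qed
    have nonadj: "\<forall>A\<in>\<B>. \<forall>C\<in>?st x - T. {A, C} \<notin> E"
      using S(2) by (auto simp: \<B>_def T_def indep_def)
    have B: "\<B> \<subseteq> ?K - ?st x" "T \<subseteq> ?st x" using S by (auto simp: \<B>_def T_def)
    show "E \<in> ?U1 \<union> ?U2 \<union> far"
    proof (cases "3 * i \<le> 2 * N")
      case False
      \<comment> \<open>As \<open>N = d x + i\<close> and \<open>d x\<close> is maximal,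
        \<open>3 * i > 2 * N\<close> puts every degree below a third of \<open>N\<close>.\<close>
      then have "\<forall>y\<in>{1..n}. 3 * card (\<S> \<inter> ?st y) \<le> N"
        using dx iT unfolding d_def by fastforce
      then have "E \<in> far" unfolding far_def using S(1-3) by blast
      then show ?thesis by simp
    next
      case True
      show ?thesis
      proof (cases "real i \<le> \<eta> * N")
        case le: True
        have "E \<in> near i x" unfolding near_def
          using B nonadj iT(1) i_def[symmetric] order_refl[of i] by blast
        moreover have "i \<in> ?I1" using le \<open>i \<noteq> 0\<close> by simp
        ultimately show ?thesis using x(1) by blast
      next
        case gt: False
        have "E \<in> mid i x" unfolding mid_def
          using B nonadj iT(1) i_def[symmetric] by blast
        moreover have "i \<in> ?I2" using gt True by simp
        ultimately show ?thesis using x(1) by blast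
      qed
    qed
  qed
  then have "measure_pmf.prob ?M ?Bad \<le> measure_pmf.prob ?M (?U1 \<union> ?U2 \<union> far)"
    by (intro measure_pmf.finite_measure_mono) auto
  also have "\<dots> \<le> measure_pmf.prob ?M ?U1 + measure_pmf.prob ?M ?U2 + measure_pmf.prob ?M far"
    using measure_Un_le[of "?U1 \<union> ?U2" ?M far] measure_Un_le[of "?U1" ?M "?U2"] by simp
  also have "measure_pmf.prob ?M far \<le> ?c"
    unfolding far_def by (rule prob_far_from_stars_le)
  also have "measure_pmf.prob ?M ?U1 \<le> sum ?f1 ?I1"
  proof -
    have "measure_pmf.prob ?M ?U1 \<le> (\<Sum>i\<in>?I1. measure_pmf.prob ?M (\<Union>x\<in>{1..n}. near i x))"
      using fin by (intro measure_pmf.finite_measure_subadditive_finite) auto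
    also have "\<dots> \<le> sum ?f1 ?I1"
    proof (rule sum_mono)
      fix i assume "i \<in> ?I1"
      then show "measure_pmf.prob ?M (\<Union>x\<in>{1..n}. near i x) \<le> ?f1 i"
        unfolding near_def using \<eta> by (intro prob_UN_le prob_near_star_le) auto
    qed
    finally show ?thesis .
  qed
  also have "measure_pmf.prob ?M ?U2 \<le> sum ?f2 ?I2"
  proof -
    have "measure_pmf.prob ?M ?U2 \<le> (\<Sum>i\<in>?I2. measure_pmf.prob ?M (\<Union>x\<in>{1..n}. mid i x))"
      using fin by (intro measure_pmf.finite_measure_subadditive_finite) auto
    also have "\<dots> \<le> sum ?f2 ?I2"
    proof (rule sum_mono)
      fix i assume "i \<in> ?I2"
      then show "measure_pmf.prob ?M (\<Union>x\<in>{1..n}. mid i x) \<le> ?f2 i"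
        unfolding mid_def using \<eta> by (intro prob_UN_le prob_mid_star_le) auto
    qed
    finally show ?thesis .
  qed
  finally show ?thesis by simp
qed

end

subsection \<open>The second moment below the threshold\<close>

lemma finite_set_pmf_random_kneser_edges [simp]: "finite (set_pmf (random_kneser_edges n r p))"
proof (rule finite_subset)
  show "set_pmf (random_kneser_edges n r p) \<subseteq> Pow (kneser_edges n r)"
    by (auto simp: random_kneser_edges_def)
qed simp

lemma finite_independent_cards: "finite V \<Longrightarrow> finite {card S | S. independent_in V E S}"
  by (rule finite_subset[of _ "card ` Pow V"]) (auto simp: independent_in_def)

lemma card_le_independence_number:
  assumes "finite V" "independent_in V E S"
  shows "card S \<le> independence_number V E"
  unfolding independence_number_def using assms by (intro Max_ge finite_independent_cards) auto

lemma independence_number_attained: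
  assumes "finite V"
  obtains S where "independent_in V E S" "card S = independence_number V E"
proof -
  have "independence_number V E \<in> {card S | S. independent_in V E S}"
    unfolding independence_number_def using assms
    by (intro Max_in finite_independent_cards) (auto simp: independent_in_def intro: exI[of _ "{}"])
  then show thesis using that by auto
qed

lemma kneser_edgeD: "{A, C} \<in> kneser_edges n r \<Longrightarrow> A \<inter> C = {}"
  by (auto simp: kneser_edges_def doubleton_eq_iff)

lemma independent_star:
  assumes "E \<subseteq> kneser_edges n r"
  shows "independent_in (kneser_verts n r) E (star_family n r x)"
  using assms kneser_edgeD[of _ _ n r]
  by (fastforce simp: independent_in_def indep_def star_family_def)

text \<open>Chebyshev's inequality for the number of events that occur: if none does, the squared
  deviation from the mean \<open>W\<close> is \<open>W ^ 2\<close>. The right-hand side is the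
  variance divided by \<open>W ^ 2\<close>.\<close>

lemma second_moment_method:
  fixes M :: "'b pmf" and a W :: real
  assumes fin: "finite I" "finite (set_pmf M)"
    and a: "\<And>i. i \<in> I \<Longrightarrow> measure_pmf.prob M (U i) = a"
    and W: "W = card I * a" "0 < W"
  shows "measure_pmf.prob M {E. \<forall>i\<in>I. E \<notin> U i}
    \<le> (\<Sum>i\<in>I. \<Sum>j\<in>I. measure_pmf.prob M (U i \<inter> U j)) / W\<^sup>2 - 1"
proof -
  let ?E = "measure_pmf.expectation M"
  let ?X = "\<lambda>E. \<Sum>i\<in>I. indicator (U i) E :: real"
  have int: "integrable (measure_pmf M) f" for f :: "'b \<Rightarrow> real"
    using fin by (intro integrable_measure_pmf_finite)
  have EX: "?E ?X = W"
    using a W by (simp add: int)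
  have "?E (\<lambda>E. (?X E - W)\<^sup>2) =
      ?E (\<lambda>E. (\<Sum>i\<in>I. \<Sum>j\<in>I. indicator (U i \<inter> U j) E) - 2 * W * ?X E + W\<^sup>2)"
    by (intro arg_cong[where f = ?E])
      (auto simp: power2_eq_square sum_product indicator_inter_arith algebra_simps)
  also have "\<dots> = ?E (\<lambda>E. \<Sum>i\<in>I. \<Sum>j\<in>I. indicator (U i \<inter> U j) E) - 2 * W * ?E ?X + W\<^sup>2"
    by (simp add: int)
  also have "?E (\<lambda>E. \<Sum>i\<in>I. \<Sum>j\<in>I. indicator (U i \<inter> U j) E) =
      (\<Sum>i\<in>I. \<Sum>j\<in>I. measure_pmf.prob M (U i \<inter> U j))"
    by (simp add: int)
  finally have var: "?E (\<lambda>E. (?X E - W)\<^sup>2) =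
      (\<Sum>i\<in>I. \<Sum>j\<in>I. measure_pmf.prob M (U i \<inter> U j)) - W\<^sup>2"
    unfolding EX by (simp add: power2_eq_square)
  have "W\<^sup>2 * measure_pmf.prob M {E. \<forall>i\<in>I. E \<notin> U i} =
      ?E (\<lambda>E. W\<^sup>2 * indicator {E. \<forall>i\<in>I. E \<notin> U i} E)"
    by (simp add: int)
  also have "\<dots> \<le> ?E (\<lambda>E. (?X E - W)\<^sup>2)"
    by (intro integral_mono int) (auto simp: indicator_def)
  finally show ?thesis unfolding var using W(2) by (simp add: field_simps)
qed

text \<open>These are the \<open>r\<close>-subsets through \<open>x\<close> of the complement of
  \<open>A\<close>. The count is exact because \<open>second_moment_method\<close> asks for events
  of equal probability.\<close>

lemma card_star_disjoint:
  assumes "A \<in> kneser_verts n r" "x \<in> {1..n}" "x \<notin> A" "1 \<le> r"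
  shows "card {C \<in> star_family n r x. A \<inter> C = {}} = (n - r - 1) choose (r - 1)"
proof -
  note A = kneser_vertsD[OF assms(1)]
  have "{C \<in> star_family n r x. A \<inter> C = {}} = {C \<in> nsets ({1..n} - A) r. {x} \<subseteq> C}"
    by (auto simp: star_family_def kneser_verts_def nsets_def)
  then show ?thesis
    using card_nsets_superset[of "{1..n} - A" "{x}" r] assms A by (simp add: card_Diff_subset)
qed

text \<open>
  The centres \<open>x\<close> and the sets \<open>A\<close> are taken from complementary parts of the ground set. Then no
  edge joins \<open>A\<close> to the star at \<open>x\<close> and also \<open>B\<close> to the star at \<open>y\<close> when \<open>A \<noteq> B\<close>.
\<close>

lemma prob_independence_number_star_le:
  fixes n r m N D M a :: nat and p W :: real
  assumes p: "0 \<le> p" "p < 1" and r: "2 \<le> r" and m: "1 \<le> m" "m \<le> n" "r \<le> n - m"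
    and N: "N = (n - 1) choose (r - 1)" and D: "D = (n - 2) choose (r - 2)"
    and M: "M = (n - r - 1) choose (r - 1)" and a: "a = (n - m) choose r"
    and W: "W = m * a * (1 - p) ^ M"
  shows "measure_pmf.prob (random_kneser_edges n r p)
      {E. independence_number (kneser_verts n r) E = N} \<le> 1 / W + 1 / ((1 - p) ^ D * a)"
proof -
  let ?K = "kneser_verts n r" and ?st = "star_family n r" and ?R = "random_kneser_edges n r p"
  define q where "q = 1 - p"
  have q: "0 < q" "q \<le> 1" using p by (auto simp: q_def)
  define As where "As = nsets {m + 1..n} r"
  have AsK: "A \<in> ?K" if "A \<in> As" for A
    using that by (auto simp: As_def kneser_verts_def nsets_def)
  have xA: "x \<notin> A" if "x \<in> {1..m}" "A \<in> As" for x A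
    using that by (auto simp: As_def nsets_def)
  have As: "finite As" "card As = a" by (simp_all add: As_def a finite_imp_finite_nsets)
  have apos: "0 < a" using m by (simp add: a)
  define G where "G x A = (\<lambda>C. {A, C}) ` {C \<in> ?st x. A \<inter> C = {}}" for x A
  have GK: "G x A \<subseteq> kneser_edges n r" if "A \<in> As" for x A
    using AsK[OF that] by (auto simp: G_def kneser_edges_def star_family_def)
  have inj: "inj_on (\<lambda>C. {A, C}) X" for A :: "nat set" and X
    by (auto simp: inj_on_def doubleton_eq_iff)
  have finG: "finite (G x A)" for x A by (simp add: G_def)
  have cardG: "card (G x A) = M" if "x \<in> {1..m}" "A \<in> As" for x A
    using card_star_disjoint[OF AsK[OF that(2)], of x] xA[OF that] that m r
    unfolding G_def M by (subst card_image[OF inj]) auto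
  define ev where "ev = (\<lambda>(x, A). {E. G x A \<inter> E = {}})"
  have prob_miss: "measure_pmf.prob ?R {E. H \<inter> E = {}} = q ^ card H" if "H \<subseteq> kneser_edges n r" for H
    using prob_random_kneser_edges[of p "{}" n r H] that p by (simp add: q_def)
  define I where "I = {1..m} \<times> As"
  have I: "finite I" "card I = m * a" using As by (simp_all add: I_def)
  have W': "W = card I * q ^ M" "0 < W" using q apos m by (simp_all add: W I q_def)
  have ev1: "measure_pmf.prob ?R (ev i) = q ^ M" if "i \<in> I" for i
    using that GK by (auto simp: I_def ev_def prob_miss cardG)
  \<comment> \<open>Different sets give disjoint edge sets, hence independent events; one set with
    two centres shares at most \<open>D\<close> edges; the diagonal contributes
    \<open>q ^ M\<close>.\<close>
  have ev2: "measure_pmf.prob ?R (ev (x, A) \<inter> ev (y, B)) \<le>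
      q ^ (2 * M) + (if A = B then q ^ (2 * M) / q ^ D else 0) + (if (x, A) = (y, B) then q ^ M else 0)"
    if xy: "x \<in> {1..m}" "y \<in> {1..m}" "A \<in> As" "B \<in> As" for x y A B
  proof -
    have "ev (x, A) \<inter> ev (y, B) = {E. (G x A \<union> G y B) \<inter> E = {}}" by (auto simp: ev_def)
    then have eq: "measure_pmf.prob ?R (ev (x, A) \<inter> ev (y, B)) = q ^ card (G x A \<union> G y B)"
      using GK xy by (simp only: prob_miss Un_least)
    have un: "card (G x A \<union> G y B) + card (G x A \<inter> G y B) = 2 * M"
      using card_Un_Int[of "G x A" "G y B"] finG cardG xy by simp
    consider "A \<noteq> B" | "A = B" "x \<noteq> y" | "A = B" "x = y" by blast
    then show ?thesis
    proof cases
      case 1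
      \<comment> \<open>A common edge would have \<open>B\<close> as its endpoint in the star at
        \<open>x\<close>, although \<open>B\<close> avoids all centres.\<close>
      have "G x A \<inter> G y B = {}"
      proof (rule equals0I)
        fix e assume "e \<in> G x A \<inter> G y B"
        then obtain C C' where "C \<in> ?st x" "{A, C} = {B, C'}" by (auto simp: G_def)
        then have "x \<in> B" using 1 by (auto simp: star_family_def doubleton_eq_iff)
        then show False using xA xy by blast
      qed
      then show ?thesis using eq un 1 by simp
    next
      case 2
      have "G x A \<inter> G y B \<subseteq> (\<lambda>C. {A, C}) ` (?st x \<inter> ?st y)"
        using 2(1) inj[of A UNIV] by (auto simp: G_def dest: injD)
      then have "card (G x A \<inter> G y B) \<le> card ((\<lambda>C. {A, C}) ` (?st x \<inter> ?st y))"
        by (intro card_mono) auto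
      also have "\<dots> \<le> D"
        using 2 xy m r by (subst card_image[OF inj]) (simp add: card_star_Int D)
      finally have "2 * M \<le> card (G x A \<union> G y B) + D" using un by simp
      then have "q ^ (card (G x A \<union> G y B) + D) \<le> q ^ (2 * M)"
        using q by (intro power_decreasing) auto
      then have "q ^ card (G x A \<union> G y B) \<le> q ^ (2 * M) / q ^ D"
        using q by (simp add: power_add field_simps)
      then show ?thesis using eq 2 q by (simp add: add_increasing)
    next
      case 3
      then show ?thesis using eq cardG xy q by simp
    qed
  qed
  have "(\<Sum>i\<in>I. \<Sum>j\<in>I. measure_pmf.prob ?R (ev i \<inter> ev j)) \<le>
      (\<Sum>i\<in>I. \<Sum>j\<in>I. q ^ (2 * M) + (if snd i = snd j then q ^ (2 * M) / q ^ D else 0)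
        + (if i = j then q ^ M else 0))"
  proof (intro sum_mono)
    fix i j assume "i \<in> I" "j \<in> I"
    then show "measure_pmf.prob ?R (ev i \<inter> ev j) \<le>
        q ^ (2 * M) + (if snd i = snd j then q ^ (2 * M) / q ^ D else 0) + (if i = j then q ^ M else 0)"
      using ev2[of "fst i" "fst j" "snd i" "snd j"] by (simp add: I_def mem_Times_iff)
  qed
  also have "\<dots> = (\<Sum>i\<in>I. card I * q ^ (2 * M) + m * (q ^ (2 * M) / q ^ D) + q ^ M)"
  proof (rule sum.cong)
    fix i assume i: "i \<in> I"
    have "{j \<in> I. snd i = snd j} = {1..m} \<times> {snd i}"
      using i by (intro equalityI subsetI) (simp_all add: I_def mem_Times_iff)
    then have "card {j \<in> I. snd i = snd j} = m" by simp
    then show "(\<Sum>j\<in>I. q ^ (2 * M) + (if snd i = snd j then q ^ (2 * M) / q ^ D else 0)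
        + (if i = j then q ^ M else 0)) = card I * q ^ (2 * M) + m * (q ^ (2 * M) / q ^ D) + q ^ M"
      using i I by (simp add: sum.distrib sum.If_cases Int_def)
  qed simp
  also have "\<dots> = W\<^sup>2 + W\<^sup>2 / (q ^ D * a) + W"
  proof -
    have *: "q ^ (2 * M) = (q ^ M)\<^sup>2" by (simp add: power_mult mult.commute)
    \<comment> \<open>Index pairs with the same set are a fraction \<open>1 / a\<close> of all index
      pairs, whence the divisor \<open>d * a\<close>.\<close>
    have "k * (k * Q\<^sup>2 + m * (Q\<^sup>2 / d) + Q) = (k * Q)\<^sup>2 + (k * Q)\<^sup>2 / (d * a) + k * Q"
      if "k = real m * a" "0 < d" for k Q d :: real
      using that(2) apos unfolding that(1) by (simp add: power2_eq_square field_simps)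
    from this[of "real (card I)" "q ^ D" "q ^ M"] show ?thesis
      using q I(2) by (simp add: W'(1) *)
  qed
  finally have S2: "(\<Sum>i\<in>I. \<Sum>j\<in>I. measure_pmf.prob ?R (ev i \<inter> ev j)) \<le> W\<^sup>2 + W\<^sup>2 / (q ^ D * a) + W" .
  have "measure_pmf.prob ?R {E. independence_number ?K E = N} \<le>
      measure_pmf.prob ?R {E. \<forall>i\<in>I. E \<notin> ev i}"
  proof (rule prob_random_kneser_mono)
    fix E assume EK: "E \<subseteq> kneser_edges n r" and E: "E \<in> {E. independence_number ?K E = N}"
    \<comment> \<open>If one of the events occurs, adding \<open>A\<close> to the star gives an
      independent set with \<open>N + 1\<close> members.\<close>
    have False if xA': "(x, A) \<in> I" "E \<in> ev (x, A)" for x A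
    proof -
      have x: "x \<in> {1..n}" and A: "A \<in> ?K" "x \<notin> A"
        using xA' xA AsK m by (auto simp: I_def)
      have "{A, C} \<notin> E" if "C \<in> ?st x" for C
      proof (cases "A \<inter> C = {}")
        case True
        then show ?thesis using xA' that by (auto simp: ev_def G_def)
      next
        case False
        then show ?thesis using EK kneser_edgeD by blast
      qed
      then have "independent_in ?K E (insert A (?st x))"
        using independent_star[OF EK, of x] A
        by (auto simp: independent_in_def indep_def insert_commute)
      then have "card (insert A (?st x)) \<le> independence_number ?K E"
        by (intro card_le_independence_number) auto
      moreover have "card (insert A (?st x)) = N + 1"
      proof -
        have "A \<notin> ?st x" using A by (simp add: star_family_def)
        then show ?thesis using x r by (simp add: card_star N)
      qed
      ultimately show False using E by simp
    qed
    then have "E \<notin> ev i" if "i \<in> I" for i using that by (cases i) blast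
    then show "E \<in> {E. \<forall>i\<in>I. E \<notin> ev i}" by simp
  qed
  also have "\<dots> \<le> (\<Sum>i\<in>I. \<Sum>j\<in>I. measure_pmf.prob ?R (ev i \<inter> ev j)) / W\<^sup>2 - 1"
    using I W' by (intro second_moment_method[OF _ _ ev1]) auto
  also have "\<dots> \<le> (W\<^sup>2 + W\<^sup>2 / (q ^ D * a) + W) / W\<^sup>2 - 1"
    using S2 by (intro diff_right_mono divide_right_mono) auto
  also have "\<dots> = 1 / W + 1 / (q ^ D * a)"
    using W'(2) by (simp add: add_divide_distrib power2_eq_square)
  finally show ?thesis by (simp add: q_def)
qed

subsection \<open>Estimates in terms of \<open>n\<close>\<close>

text \<open>Compare one term of the expansion of \<open>(1 + x) ^ n\<close> at
  \<open>x = k / n\<close> with the whole, which is at most \<open>exp k\<close>.\<close>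

lemma binomial_le_exp_pow:
  assumes "0 < k" "0 < n"
  shows "real (n choose k) \<le> (exp 1 * n / k) ^ k"
proof -
  define x where "x = real k / n"
  have x: "0 < x" using assms by (simp add: x_def)
  have "real (n choose k) * x ^ k \<le> (1 + x) ^ n"
  proof (cases "k \<le> n")
    case True
    have "(1 + x) ^ n = (\<Sum>j\<le>n. of_nat (n choose j) * x ^ j)"
      using binomial_ring[of x 1 n] by (simp add: add.commute)
    moreover have "of_nat (n choose k) * x ^ k \<le> (\<Sum>j\<le>n. of_nat (n choose j) * x ^ j)"
      using x True by (intro member_le_sum) auto
    ultimately show ?thesis by simp
  qed (use x in \<open>simp add: binomial_eq_0\<close>)
  also have "\<dots> \<le> exp x ^ n" using x by (intro power_mono) auto
  also have "\<dots> = exp 1 ^ k" using assms by (simp add: x_def flip: exp_of_nat_mult)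
  finally have "real (n choose k) \<le> exp 1 ^ k / x ^ k" using x by (simp add: field_simps)
  then show ?thesis by (simp add: x_def power_divide power_mult_distrib field_simps)
qed

lemma binomial_ge_self:
  assumes "1 \<le> k" "k < n"
  shows "n \<le> n choose k"
  using assms
proof (induction n arbitrary: k)
  case (Suc n)
  obtain j where k: "k = Suc j" using Suc.prems by (cases k) auto
  show ?case
  proof (cases "k = n")
    case True
    then show ?thesis by simp
  next
    case False
    then have "n \<le> n choose k" using Suc by simp
    moreover have "1 \<le> n choose j" using Suc.prems k by (simp add: Suc_le_eq)
    ultimately show ?thesis by (simp add: k)
  qed
qed simp

text \<open>The numerator of \<open>p_crit\<close>. For positive \<open>n\<close> and
  \<open>r\<close> its exponential is \<open>n * (n / r) ^ r\<close>, which up to a factor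
  \<open>exp r\<close> bounds the number of pairs of a centre and a vertex.\<close>

definition crit_log :: "nat \<Rightarrow> nat \<Rightarrow> real" where
  "crit_log n r = (real r + 1) * ln (real n) - real r * ln (real r)"

lemma p_crit_eq: "p_crit n r = crit_log n r / real ((n - 1) choose (r - 1))"
  by (simp add: p_crit_def crit_log_def)

section \<open>Sizes and exponents for fixed \<open>n\<close>\<close>

context
  fixes n r N D V :: nat
  assumes r: "2 \<le> r" "r < n" "r ^ 3 \<le> n"
    and N: "N = (n - 1) choose (r - 1)" and D: "D = (n - 2) choose (r - 2)" and V: "V = n choose r"
begin

lemma star_size_ge: "n - 1 \<le> N"
  unfolding N using r by (intro binomial_ge_self) auto

lemma star_size_pos: "0 < N"
  using r by (simp add: N)

text \<open>The absorption identity; it gives the ratio \<open>(r - 1) / (n - 1)\<close> of codegree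
  to degree.\<close>

lemma codegree_eq: "(n - 1) * D = (r - 1) * N"
  using times_binomial_minus1_eq[of "r - 1" "n - 1"] r by (simp add: N D numeral_2_eq_2)

lemma verts_eq: "r * V = n * N"
  using times_binomial_minus1_eq[of r n] r by (simp add: N V)

lemma ln_r_le: "3 * ln (real r) \<le> ln (real n)"
proof -
  have "3 * ln (real r) = ln (real r ^ 3)" using r by (simp add: ln_realpow)
  also have "\<dots> \<le> ln (real n)"
    using r of_nat_mono[OF r(3), where 'a = real] by (intro ln_mono) auto
  finally show ?thesis .
qed

text \<open>As \<open>3 * ln r \<le> ln n\<close>, subtracting \<open>r * ln r\<close> costs at most
  a third of \<open>r * ln n\<close>. A fixed share of \<open>crit_log\<close> is thus of order
  \<open>r * ln n\<close> and outweighs error factors \<open>exp r\<close>.\<close>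

lemma crit_log_ge: "2 / 3 * (real r + 1) * ln n \<le> crit_log n r"
proof -
  have "real r * (3 * ln r) \<le> real r * ln n" using ln_r_le by (intro mult_left_mono) auto
  moreover have "0 \<le> ln (real n)" using r by simp
  moreover have "crit_log n r - 2 / 3 * (real r + 1) * ln n =
      (ln n + (real r * ln n - real r * (3 * ln r))) / 3"
    by (simp add: crit_log_def field_simps)
  ultimately have "0 \<le> crit_log n r - 2 / 3 * (real r + 1) * ln n" by simp
  then show ?thesis by simp
qed

text \<open>The factor 3 comes from \<open>r + 1 \<ge> 3\<close>. It makes up for the mere
  \<open>1 / 3 - \<eta>\<close> in the exponents of \<open>prob_mid_star_le\<close> and
  \<open>prob_far_from_stars_le\<close>.\<close>

lemma crit_log_ge_ratio: "3 * ln (real n / r) \<le> crit_log n r"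
proof -
  have nr: "0 \<le> ln (real n / r)" "0 \<le> ln (real r)" using r by auto
  have "3 * ln (real n / r) \<le> (real r + 1) * ln (real n / r)"
    using r nr by (intro mult_right_mono) auto
  also have "\<dots> \<le> crit_log n r" using r nr(2) by (simp add: crit_log_def ln_div algebra_simps)
  finally show ?thesis .
qed

lemma ln_ratio_ge: "2 / 3 * ln n \<le> ln (real n / r)"
  using ln_r_le r by (simp add: ln_div)

lemma verts_le: "real n * V \<le> exp (crit_log n r + r)"
proof -
  have "real V \<le> (exp 1 * n / r) ^ r" unfolding V using r by (intro binomial_le_exp_pow) auto
  also have "exp 1 * n / r = exp (1 + ln n - ln r)" using r by (simp add: exp_add exp_diff)
  also have "\<dots> ^ r = exp (r * (1 + ln n - ln r))" by (simp flip: exp_of_nat_mult)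
  finally have "real n * V \<le> exp (ln n) * exp (r * (1 + ln n - ln r))" using r by simp
  also have "\<dots> = exp (crit_log n r + r)" by (simp add: crit_log_def algebra_simps flip: exp_add)
  finally show ?thesis .
qed

text \<open>The choice of \<open>\<eta>\<close> gives
  \<open>(1 + \<epsilon>) * (1 - 3 * \<eta>) = 1 + \<epsilon> / 2\<close>, so half of the surplus
  survives the losses. By \<open>crit_log_ge\<close> this half is worth at least
  \<open>(r + 1) * t\<close> in the exponent.\<close>

lemma prob_nonstar_indep_small:
  fixes p \<epsilon> \<eta> t :: real
  assumes p: "0 \<le> p" "p \<le> 1" "p \<ge> (1 + \<epsilon>) * p_crit n r" and \<epsilon>: "0 < \<epsilon>"
    and \<eta>: "\<eta> = \<epsilon> / (6 * (1 + \<epsilon>))" and t: "t = \<epsilon> / 3 * ln n" "1 \<le> t"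
    and DN: "9 * (real r)\<^sup>2 * D < \<eta> ^ 3 * N"
    and small1: "exp (- t) / \<eta> \<le> 1 / 2" and small2: "exp 2 / \<eta>\<^sup>2 * exp (- t) \<le> exp (- 1)"
  shows "measure_pmf.prob (random_kneser_edges n r p)
      {E. \<exists>\<S>. independent_in (kneser_verts n r) E \<S> \<and> card \<S> = N \<and>
        (\<forall>x\<in>{1..n}. \<S> \<noteq> star_family n r x)}
    \<le> 2 / \<eta> * exp (- t) + (real N + 1)\<^sup>2 * exp (- \<eta> * N) + exp 1 * exp (- t)"
proof -
  define L where "L = crit_log n r"
  have \<eta>01: "0 < \<eta>" "\<eta> \<le> 1" "1 - 3 * \<eta> \<ge> 0" using \<epsilon> by (auto simp: \<eta> field_simps)
  have \<eta>eq: "(1 + \<epsilon>) * (1 - 3 * \<eta>) = 1 + \<epsilon> / 2" using \<epsilon> by (simp add: \<eta> field_simps)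
  have Npos: "0 < real N" using star_size_pos by simp
  have npos: "0 < real n" "0 < real r" using r by auto
  have "p_crit n r = L / N" by (simp add: p_crit_eq L_def N)
  then have pN: "(1 + \<epsilon>) * L \<le> p * N" using p(3) Npos by (simp add: pos_divide_le_eq)
  have pN1: "(1 + \<epsilon> / 2) * L \<le> p * N * (1 - 3 * \<eta>)"
    using mult_right_mono[OF pN \<eta>01(3)] \<eta>eq by (metis mult.assoc mult.commute)
  \<comment> \<open>\<open>1 - 3 * \<eta>\<close> is three times \<open>1 / 3 - \<eta>\<close>,
    which cancels the 3 in \<open>crit_log_ge_ratio\<close>.\<close>
  have ratio: "(1 + \<epsilon> / 2) * ln (real n / r) \<le> p * (N * (1 / 3 - \<eta>))"
  proof -
    have "(1 + \<epsilon> / 2) * (3 * ln (real n / r)) \<le> (1 + \<epsilon> / 2) * L"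
      using crit_log_ge_ratio \<epsilon> unfolding L_def by (intro mult_left_mono) auto
    also note pN1
    finally show ?thesis by (simp add: algebra_simps)
  qed
  have ratio': "real n / r * exp (- p * (N * (1 / 3 - \<eta>))) \<le> exp (- t)"
  proof -
    have "t \<le> \<epsilon> / 2 * ln (real n / r)"
      using mult_left_mono[OF ln_ratio_ge, of "\<epsilon> / 2"] \<epsilon> by (simp add: t)
    then have "ln (real n / r) - p * (N * (1 / 3 - \<eta>)) \<le> - t"
      using ratio by (simp add: algebra_simps)
    then have "exp (ln (real n / r) + - p * (N * (1 / 3 - \<eta>))) \<le> exp (- t)" by simp
    then show ?thesis using npos by (simp only: exp_add exp_ln zero_less_divide_iff simp_thms)
  qed
  have Vr: "real V / N = real n / r"
    using arg_cong[OF verts_eq, of real] npos Npos by (simp add: field_simps)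
  have Vpos: "0 < V" using r by (simp add: V)

  have T1: "(\<Sum>i | 1 \<le> i \<and> real i \<le> \<eta> * N.
      n * ((V choose i) * ((1 / \<eta>) ^ i * exp (- p * (i * (N * (1 - 3 * \<eta>))))))) \<le> 2 / \<eta> * exp (- t)"
    (is "sum ?f ?I \<le> _")
  proof -
    \<comment> \<open>\<open>b\<close> bounds the cost of one outside member; the sum is at most
      \<open>n\<close> times a geometric series with ratio at most 1/2, governed by
      \<open>i = 1\<close>.\<close>
    define b where "b = V / \<eta> * exp (- p * (N * (1 - 3 * \<eta>)))"
    have b0: "0 \<le> b" using \<eta>01 by (simp add: b_def)
    \<comment> \<open>Of the surplus \<open>(r + 1) * t\<close>, the part \<open>r * t\<close> pays
      for the \<open>exp r\<close> in \<open>verts_le\<close>, and \<open>t\<close> remains.\<close>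
    have "L + r - (1 + \<epsilon> / 2) * L \<le> - t"
    proof -
      have "(real r + 1) * t \<le> \<epsilon> / 2 * L"
        using mult_left_mono[OF crit_log_ge, of "\<epsilon> / 2"] \<epsilon> by (simp add: t L_def algebra_simps)
      moreover have "real r * 1 \<le> real r * t" using t by (intro mult_left_mono) auto
      ultimately show ?thesis by (simp add: algebra_simps)
    qed
    then have "exp (L + r) * exp (- p * (N * (1 - 3 * \<eta>))) \<le> exp (- t)"
      using pN1 by (simp add: algebra_simps flip: exp_add)
    moreover have "real n * V * exp (- p * (N * (1 - 3 * \<eta>))) \<le> exp (L + r) * exp (- p * (N * (1 - 3 * \<eta>)))"
      using verts_le by (intro mult_right_mono) (auto simp: L_def)
    ultimately have "real n * V * exp (- p * (N * (1 - 3 * \<eta>))) \<le> exp (- t)" by linarith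
    then have "real n * V * exp (- p * (N * (1 - 3 * \<eta>))) / \<eta> \<le> exp (- t) / \<eta>"
      using \<eta>01 by (intro divide_right_mono) auto
    then have nb: "n * b \<le> exp (- t) / \<eta>" by (simp add: b_def)
    have "b \<le> n * b" using b0 npos r by (simp add: mult_le_cancel_right1)
    then have b1: "b \<le> 1 / 2" using nb small1 by linarith
    have "sum ?f ?I \<le> (\<Sum>i\<in>?I. n * b ^ i)"
    proof (rule sum_mono)
      fix i assume i: "i \<in> ?I"
      have "real (V choose i) \<le> real V ^ i"
      proof (cases "i \<le> V")
        case True
        then show ?thesis using of_nat_mono[OF binomial_le_pow, of i V, where 'a = real] by simp
      qed (simp add: binomial_eq_0)
      then have "real (V choose i) * ((1 / \<eta>) ^ i * exp (- p * (i * (N * (1 - 3 * \<eta>)))))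
          \<le> real V ^ i * ((1 / \<eta>) ^ i * exp (- p * (i * (N * (1 - 3 * \<eta>)))))"
        using \<eta>01 by (intro mult_right_mono) auto
      also have "\<dots> = b ^ i"
      proof -
        have "exp (- p * (i * (N * (1 - 3 * \<eta>)))) = exp (- p * (N * (1 - 3 * \<eta>))) ^ i"
          by (simp add: mult_ac flip: exp_of_nat_mult)
        then show ?thesis by (simp add: b_def power_mult_distrib power_divide)
      qed
      finally show "?f i \<le> n * b ^ i" by (intro mult_left_mono) auto
    qed
    also have "\<dots> \<le> (\<Sum>i\<in>{1..N}. n * b ^ i)"
    proof (rule sum_mono2)
      show "?I \<subseteq> {1..N}"
      proof
        fix i assume "i \<in> ?I"
        moreover have "\<eta> * N \<le> N" using \<eta>01 Npos by simp
        ultimately have "1 \<le> i" "real i \<le> N" by auto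
        then show "i \<in> {1..N}" by simp
      qed
    qed (use b0 in auto)
    also have "\<dots> \<le> 2 * (n * b)"
    proof -
      \<comment> \<open>The subtracted term lets the induction close, given
        \<open>b \<le> 1 / 2\<close>.\<close>
      have "(\<Sum>i\<in>{1..k}. b ^ i) \<le> 2 * b - 2 * b * b ^ k" for k
      proof (induction k)
        case 0
        then show ?case using b0 by simp
      next
        case (Suc k)
        have "2 * b * (b ^ k * b) \<le> 1 * (b ^ k * b)" using b0 b1 by (intro mult_right_mono) auto
        then show ?case using Suc by (simp add: algebra_simps)
      qed
      then have "(\<Sum>i\<in>{1..N}. b ^ i) \<le> 2 * b"
        using b0 by (smt (verit) mult_nonneg_nonneg zero_le_power)
      then have "n * (\<Sum>i\<in>{1..N}. b ^ i) \<le> n * (2 * b)" by (intro mult_left_mono) auto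
      then show ?thesis by (simp add: sum_distrib_left mult_ac)
    qed
    also have "\<dots> \<le> 2 * (exp (- t) / \<eta>)" using nb by simp
    finally show ?thesis by simp
  qed

  have T2: "(\<Sum>i | \<eta> * N < real i \<and> 3 * i \<le> 2 * N.
      n * ((V choose i) * ((N choose i) * exp (- p * (i * (N * (1 / 3 - \<eta>)))))))
      \<le> (real N + 1)\<^sup>2 * exp (- \<eta> * N)" (is "sum ?f ?I \<le> _")
  proof -
    \<comment> \<open>For \<open>i > \<eta> * N\<close> the two binomial coefficients are at most
      \<open>i\<close>-th powers with bases \<open>exp 1 / \<eta> * (n / r)\<close> and
      \<open>exp 1 / \<eta>\<close>. By \<open>ratio'\<close> and \<open>small2\<close> each of the
      \<open>i\<close> factors is then at most \<open>exp (- 1)\<close>.\<close>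
    have "sum ?f ?I \<le> (\<Sum>i\<in>?I. n * exp (- \<eta> * N))"
    proof (rule sum_mono)
      fix i assume i: "i \<in> ?I"
      have ipos: "0 < real i" using i \<eta>01 Npos
        by (smt (verit, best) mem_Collect_eq mult_nonneg_nonneg)
      have "real (V choose i) \<le> (exp 1 * V / i) ^ i"
        using ipos Vpos by (intro binomial_le_exp_pow) auto
      also have "\<dots> \<le> (exp 1 * V / (\<eta> * N)) ^ i"
        using i ipos \<eta>01 Npos by (intro power_mono divide_left_mono) auto
      also have "exp 1 * V / (\<eta> * N) = exp 1 / \<eta> * (n / r)" unfolding Vr[symmetric] by simp
      finally have c1: "real (V choose i) \<le> (exp 1 / \<eta> * (n / r)) ^ i" .
      have "real (N choose i) \<le> (exp 1 * N / i) ^ i"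
        using ipos Npos by (intro binomial_le_exp_pow) auto
      also have "\<dots> \<le> (exp 1 * N / (\<eta> * N)) ^ i"
        using i ipos \<eta>01 Npos by (intro power_mono divide_left_mono) auto
      also have "exp 1 * N / (\<eta> * N) = exp 1 / \<eta>" using Npos by simp
      finally have c2: "real (N choose i) \<le> (exp 1 / \<eta>) ^ i" .
      have "exp (- p * (i * (N * (1 / 3 - \<eta>)))) = exp (- p * (N * (1 / 3 - \<eta>))) ^ i"
        by (simp add: mult_ac flip: exp_of_nat_mult)
      then have "real (V choose i) * (real (N choose i) * exp (- p * (i * (N * (1 / 3 - \<eta>)))))
          \<le> (exp 1 / \<eta> * (n / r)) ^ i * ((exp 1 / \<eta>) ^ i * exp (- p * (N * (1 / 3 - \<eta>))) ^ i)"
        using c1 c2 \<eta>01 by (simp only:, intro mult_mono) auto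
      also have "\<dots> = (exp 2 / \<eta>\<^sup>2 * (n / r * exp (- p * (N * (1 / 3 - \<eta>))))) ^ i"
      proof -
        have "exp 2 = exp 1 * exp (1 :: real)" by (simp flip: exp_add)
        then show ?thesis by (simp add: power2_eq_square mult_ac flip: power_mult_distrib)
      qed
      also have "\<dots> \<le> exp (- 1) ^ i"
      proof (rule power_mono)
        have "exp 2 / \<eta>\<^sup>2 * (n / r * exp (- p * (N * (1 / 3 - \<eta>)))) \<le> exp 2 / \<eta>\<^sup>2 * exp (- t)"
          using ratio' by (intro mult_left_mono) auto
        also note small2
        finally show "exp 2 / \<eta>\<^sup>2 * (n / r * exp (- p * (N * (1 / 3 - \<eta>)))) \<le> exp (- 1)" .
      qed simp
      also have "\<dots> = exp (- real i)" by (simp flip: exp_of_nat_mult)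
      also have "\<dots> \<le> exp (- \<eta> * N)" using i by simp
      finally show "?f i \<le> n * exp (- \<eta> * N)" by (intro mult_left_mono) auto
    qed
    also have "\<dots> = card ?I * (n * exp (- \<eta> * N))" by simp
    also have "\<dots> \<le> (real N + 1) * ((real N + 1) * exp (- \<eta> * N))"
    proof (intro mult_mono)
      have "card ?I \<le> card {..N}" by (intro card_mono) auto
      then show "real (card ?I) \<le> real N + 1" by simp
      show "real n \<le> real N + 1" using star_size_ge by linarith
    qed auto
    finally show ?thesis by (simp add: power2_eq_square mult_ac)
  qed

  have T3: "(V choose N) * exp (- p * ((real N)\<^sup>2 * (1 / 3 - \<eta>))) \<le> exp 1 * exp (- t)"
  proof -
    have "real (V choose N) \<le> (exp 1 * V / N) ^ N"
      using star_size_pos Vpos by (intro binomial_le_exp_pow) auto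
    also have "exp 1 * V / N = exp 1 * (n / r)" unfolding Vr[symmetric] by simp
    finally have c: "real (V choose N) \<le> (exp 1 * (n / r)) ^ N" .
    have "exp (- p * ((real N)\<^sup>2 * (1 / 3 - \<eta>))) = exp (- p * (N * (1 / 3 - \<eta>))) ^ N"
      by (simp add: mult_ac power2_eq_square flip: exp_of_nat_mult)
    then have "real (V choose N) * exp (- p * ((real N)\<^sup>2 * (1 / 3 - \<eta>)))
        \<le> (exp 1 * (n / r)) ^ N * exp (- p * (N * (1 / 3 - \<eta>))) ^ N"
      using c by (simp only:, intro mult_right_mono) auto
    also have "\<dots> = (exp 1 * (n / r * exp (- p * (N * (1 / 3 - \<eta>))))) ^ N"
      by (simp add: mult_ac flip: power_mult_distrib)
    also have "\<dots> \<le> (exp 1 * exp (- t)) ^ N"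
      using ratio' by (intro power_mono mult_left_mono) auto
    \<comment> \<open>The base is at most 1 because \<open>t \<ge> 1\<close>, so the
      \<open>N\<close>-th power is at most the first.\<close>
    also have "\<dots> \<le> exp 1 * exp (- t)"
    proof -
      have "exp 1 * exp (- t) \<le> 1" using t(2) by (simp flip: exp_add)
      then show ?thesis using power_decreasing[of 1 N "exp 1 * exp (- t)"] star_size_pos by simp
    qed
    finally show ?thesis .
  qed

  show ?thesis
    using prob_nonstar_indep_le[OF p(1,2) r(1) \<eta>01(1,2) N star_size_pos D DN] T1 T2 T3
    unfolding V[symmetric] by linarith
qed

section \<open>The second moment bound for fixed \<open>n\<close> below the threshold\<close>

lemma crit_log_le: "crit_log n r \<le> (real r + 1) * ln n"
  using r by (simp add: crit_log_def)

text \<open>Replacing \<open>1 - p\<close> by \<open>exp (- ((1 + \<epsilon>) * p))\<close> turns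
  the factor \<open>1 - \<epsilon>\<close> into \<open>1 - \<epsilon> ^ 2\<close>. The share
  \<open>\<epsilon> ^ 2\<close> of \<open>crit_log\<close> that is left is at least
  \<open>(r + 1) * s\<close> by \<open>crit_log_ge\<close>.\<close>

lemma prob_independence_number_star_small:
  fixes p \<epsilon> s :: real
  assumes p: "0 \<le> p" "p \<le> (1 - \<epsilon>) * p_crit n r" and \<epsilon>: "0 < \<epsilon>" "\<epsilon> < 1"
    and s: "s = 2 / 3 * \<epsilon>\<^sup>2 * ln n" "1 \<le> s"
    and small1: "(real r + 1) * ln n \<le> \<epsilon> / 2 * real (n - 1)"
    and small2: "real r * (real r + 1) * ln n \<le> real (n - 1)"
    and small3: "2 * r \<le> n"
  shows "measure_pmf.prob (random_kneser_edges n r p)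
      {E. independence_number (kneser_verts n r) E = N} \<le> 3 * exp (- s) + exp 2 * (2 * real r / n)"
proof -
  define L where "L = crit_log n r"
  define P where "P = (1 - \<epsilon>) * L / N"
  \<comment> \<open>The first half of the ground set supplies the centres, the rest the sets outside
    the stars.\<close>
  define m where "m = n div 2"
  define M where "M = (n - r - 1) choose (r - 1)"
  define a where "a = (n - m) choose r"
  have Npos: "0 < real N" using star_size_pos by simp
  have npos: "0 < real n" "0 < real r" "0 < real (n - 1)" using r by auto
  have lnn: "0 \<le> ln (real n)" using r by simp
  have L0: "0 \<le> L"
  proof -
    have "0 \<le> 2 / 3 * (real r + 1) * ln n" using lnn by simp
    then show ?thesis using crit_log_ge unfolding L_def by linarith
  qed
  have pP: "p \<le> P" using p(2) by (simp add: p_crit_eq P_def L_def N)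
  have "P \<le> L / N" unfolding P_def using \<epsilon> L0 Npos by (intro divide_right_mono mult_left_le_one_le) auto
  also have "\<dots> \<le> ((real r + 1) * ln n) / real (n - 1)"
    using star_size_ge crit_log_le npos lnn L0 unfolding L_def by (intro frac_le) auto
  also have "\<dots> \<le> \<epsilon> / 2" using small1 npos by (simp add: pos_divide_le_eq)
  finally have P2: "P \<le> \<epsilon> / 2" .
  \<comment> \<open>As \<open>P \<le> \<epsilon> / 2\<close>, the quadratic term in the lower bound
    for \<open>ln (1 - p)\<close> is at most \<open>\<epsilon> * p\<close>.\<close>
  have miss: "exp (- (real k * ((1 + \<epsilon>) * P))) \<le> (1 - p) ^ k" for k
  proof -
    have "2 * p * p \<le> \<epsilon> * p" using pP P2 p by (intro mult_right_mono) auto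
    then have "- ((1 + \<epsilon>) * p) \<le> - p - 2 * p\<^sup>2" by (simp add: power2_eq_square algebra_simps)
    also have "\<dots> \<le> ln (1 - p)"
      using p pP P2 \<epsilon> by (intro ln_one_minus_pos_lower_bound) auto
    finally have "- ((1 + \<epsilon>) * p) \<le> ln (1 - p)" .
    moreover have "(1 + \<epsilon>) * p \<le> (1 + \<epsilon>) * P" using pP \<epsilon> by (intro mult_left_mono) auto
    ultimately have "exp (- ((1 + \<epsilon>) * P)) \<le> exp (ln (1 - p))" by simp
    then have "exp (- ((1 + \<epsilon>) * P)) \<le> 1 - p" using pP P2 \<epsilon> by simp
    then have "exp (- ((1 + \<epsilon>) * P)) ^ k \<le> (1 - p) ^ k" by (intro power_mono) auto
    then show ?thesis by (simp flip: exp_of_nat_mult)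
  qed
  have P0: "0 \<le> P" using p pP by linarith
  have M: "exp (- ((1 - \<epsilon>\<^sup>2) * L)) \<le> (1 - p) ^ M"
  proof -
    have "M \<le> N" unfolding M_def N by (intro binomial_right_mono) auto
    then have "real M * ((1 + \<epsilon>) * P) \<le> real N * ((1 + \<epsilon>) * P)"
      using \<epsilon> P0 by (intro mult_right_mono) auto
    also have "\<dots> = (1 + \<epsilon>) * (1 - \<epsilon>) * L" using Npos by (simp add: P_def)
    also have "\<dots> = (1 - \<epsilon>\<^sup>2) * L" by (simp add: power2_eq_square algebra_simps)
    finally show ?thesis using miss[of M] by (smt (verit) exp_le_cancel_iff)
  qed
  \<comment> \<open>The edges that one set may share between two stars are few: by
    \<open>codegree_eq\<close> and \<open>small2\<close> the exponent for missing \<open>D\<close>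
    edges is at most 2.\<close>
  have D2: "exp (- 2) \<le> (1 - p) ^ D"
  proof -
    have "real D / N = real (r - 1) / real (n - 1)"
      using arg_cong[OF codegree_eq, of real] npos Npos by (simp add: field_simps)
    then have "real D * L / N = real (r - 1) * L / real (n - 1)" by (metis times_divide_eq_left)
    also have "\<dots> \<le> real r * ((real r + 1) * ln n) / real (n - 1)"
      using crit_log_le L0 lnn by (intro divide_right_mono mult_mono) (auto simp: L_def)
    also have "\<dots> \<le> 1" using small2 npos by (simp add: mult.assoc)
    finally have DL: "real D * L / N \<le> 1" .
    have "(1 + \<epsilon>) * (1 - \<epsilon>) \<le> 2" using \<epsilon> by (simp add: algebra_simps)
    then have "(1 + \<epsilon>) * (1 - \<epsilon>) * (real D * L / N) \<le> 2 * 1"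
      using DL L0 by (intro mult_mono) auto
    then have "real D * ((1 + \<epsilon>) * P) \<le> 2" by (simp add: P_def mult_ac)
    then show ?thesis using miss[of D] by (smt (verit) exp_le_cancel_iff)
  qed
  have m: "1 \<le> m" "m \<le> n" "real n / 3 \<le> m" "real n / 2 \<le> real (n - m)"
    using r unfolding m_def by linarith+
  have rm: "r \<le> n - m" using small3 by (simp add: m_def)
  have apow: "(real n / (2 * r)) ^ r \<le> a"
  proof -
    have "(real n / (2 * r)) ^ r \<le> (real (n - m) / real r) ^ r"
      using m npos by (intro power_mono) (auto simp: field_simps)
    also have "\<dots> \<le> a" unfolding a_def using rm by (intro binomial_ge_n_over_k_pow_k)
    finally show ?thesis .
  qed
  define W where "W = m * a * (1 - p) ^ M"
  have W: "exp s / 3 \<le> W"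
  proof -
    have "(real n / (2 * r)) ^ r = exp (r * (ln n - ln r)) / 2 ^ r"
    proof -
      have "exp (r * (ln n - ln r)) = exp (ln n - ln r) ^ r" by (simp add: exp_of_nat_mult)
      also have "exp (ln n - ln r) = real n / r" using npos by (simp add: exp_diff)
      finally show ?thesis by (simp add: power_divide power_mult_distrib)
    qed
    \<comment> \<open>The loss of \<open>2 ^ r\<close> from halving the ground set is absorbed into
      \<open>exp r\<close>.\<close>
    moreover have "exp (- real r) \<le> 1 / 2 ^ r"
    proof -
      have "(2::real) ^ r \<le> exp 1 ^ r" using exp_ge_add_one_self[of 1] by (intro power_mono) auto
      also have "\<dots> = exp (real r)" by (simp flip: exp_of_nat_mult)
      finally show ?thesis by (simp add: exp_minus inverse_eq_divide divide_left_mono)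
    qed
    ultimately have "exp (r * (ln n - ln r)) * exp (- real r) \<le> (real n / (2 * r)) ^ r"
      by (metis (no_types, lifting) exp_ge_zero mult_left_mono mult.right_neutral times_divide_eq_right)
    then have "exp (r * (ln n - ln r) + - real r) \<le> a" using apow unfolding exp_add by linarith
    then have a': "exp (r * (ln n - ln r) - r) \<le> a" by simp
    \<comment> \<open>Of the \<open>r + 1\<close> portions \<open>s\<close> of the surplus,
      \<open>r\<close> pay for \<open>exp r\<close> and one is left.\<close>
    have "s \<le> \<epsilon>\<^sup>2 * L - r"
    proof -
      have "(real r + 1) * s \<le> \<epsilon>\<^sup>2 * L"
        using mult_left_mono[OF crit_log_ge, of "\<epsilon>\<^sup>2"] by (simp add: s L_def algebra_simps)
      moreover have "real r * 1 \<le> real r * s" using s(2) by (intro mult_left_mono) auto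
      ultimately show ?thesis by (simp add: algebra_simps)
    qed
    also have "\<epsilon>\<^sup>2 * L - r = ln n + (r * (ln n - ln r) - r) + - ((1 - \<epsilon>\<^sup>2) * L)"
      by (simp add: L_def crit_log_def algebra_simps)
    finally have "exp s / 3 \<le> exp (ln n + (r * (ln n - ln r) - r) + - ((1 - \<epsilon>\<^sup>2) * L)) / 3" by simp
    also have "\<dots> = real n / 3 * exp (r * (ln n - ln r) - r) * exp (- ((1 - \<epsilon>\<^sup>2) * L))"
      using npos by (simp only: exp_add exp_ln times_divide_eq_left)
    also have "\<dots> \<le> real m * real a * (1 - p) ^ M"
      using m a' M by (intro mult_mono) auto
    finally show ?thesis by (simp add: W_def)
  qed
  have "0 < W" by (rule less_le_trans[OF _ W]) simp
  then have "1 / W \<le> 1 / (exp s / 3)" using W by (intro divide_left_mono) auto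
  then have b1: "1 / W \<le> 3 * exp (- s)" by (simp add: exp_minus field_simps)
  have b2: "1 / ((1 - p) ^ D * a) \<le> exp 2 * (2 * real r / n)"
  proof -
    have "1 \<le> real n / (2 * r)" using of_nat_mono[OF small3, where 'a = real] npos by simp
    then have "(real n / (2 * r)) ^ 1 \<le> (real n / (2 * r)) ^ r" using r by (intro power_increasing) auto
    then have "real n / (2 * r) \<le> a" using apow by simp
    then have "exp (- 2) * (real n / (2 * r)) \<le> (1 - p) ^ D * a"
      using D2 order_trans[OF exp_ge_zero D2] by (intro mult_mono) auto
    moreover have "0 < exp (- 2) * (real n / (2 * r))" using npos by simp
    ultimately have "1 / ((1 - p) ^ D * a) \<le> 1 / (exp (- 2) * (real n / (2 * r)))"
      by (intro frac_le) simp_all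
    then show ?thesis by (simp add: exp_minus field_simps)
  qed
  have "p < 1" using pP P2 \<epsilon> by simp
  then have "measure_pmf.prob (random_kneser_edges n r p)
      {E. independence_number (kneser_verts n r) E = N} \<le> 1 / W + 1 / ((1 - p) ^ D * a)"
    using p r m rm N D M_def a_def W_def
    by (intro prob_independence_number_star_le[where m = m and M = M]) auto
  then show ?thesis using b1 b2 by linarith
qed

end

subsection \<open>Limits\<close>

text \<open>From a larger independent set take \<open>N + 1\<close> members. Removing any one leaves
  a star, and two removals give stars with different centres sharing \<open>N - 1\<close> members,
  more than the codegree allows.\<close>

lemma independence_number_eq_if_only_stars:
  assumes r: "2 \<le> r" "r + 2 \<le> n" "r ^ 3 \<le> n" and E: "E \<subseteq> kneser_edges n r"
    and only: "\<And>\<S>. independent_in (kneser_verts n r) E \<S> \<Longrightarrow> card \<S> = (n - 1) choose (r - 1) \<Longrightarrow>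
      \<exists>x\<in>{1..n}. \<S> = star_family n r x"
  shows "independence_number (kneser_verts n r) E = (n - 1) choose (r - 1)"
proof (rule antisym)
  define N D where "N = (n - 1) choose (r - 1)" and "D = (n - 2) choose (r - 2)"
  have cst: "card (star_family n r x) = N" if "x \<in> {1..n}" for x
    using that r by (simp add: card_star N_def)
  have "card (star_family n r 1) \<le> independence_number (kneser_verts n r) E"
    using E by (intro card_le_independence_number independent_star) auto
  then show "(n - 1) choose (r - 1) \<le> independence_number (kneser_verts n r) E"
    using r cst[of 1] by (simp add: N_def)
  show "independence_number (kneser_verts n r) E \<le> (n - 1) choose (r - 1)"
  proof (rule ccontr)
    assume "\<not> independence_number (kneser_verts n r) E \<le> (n - 1) choose (r - 1)"
    moreover obtain \<S> where S: "independent_in (kneser_verts n r) E \<S>"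
        "card \<S> = independence_number (kneser_verts n r) E"
      using independence_number_attained[OF finite_kneser_verts] by blast
    ultimately have "N + 1 \<le> card \<S>" by (simp add: N_def)
    then obtain T where T: "T \<subseteq> \<S>" "card T = N + 1" "finite T"
      using obtain_subset_with_card_n by metis
    have star: "\<exists>x\<in>{1..n}. T - {A} = star_family n r x" if "A \<in> T" for A
    proof (rule only)
      show "independent_in (kneser_verts n r) E (T - {A})"
        using S(1) T(1) smaller_indep[of \<S> E "T - {A}"] by (auto simp: independent_in_def)
      show "card (T - {A}) = (n - 1) choose (r - 1)" using that T by (simp add: N_def)
    qed
    have Npos: "0 < N" using r by (simp add: N_def)
    obtain A where A: "A \<in> T" using T by fastforce
    obtain x where x: "x \<in> {1..n}" "T - {A} = star_family n r x" using star[OF A] by blast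
    have "card (T - {A}) = N" using A T by simp
    then obtain C where C: "C \<in> T" "C \<noteq> A" using Npos by (metis card.empty Diff_iff ex_in_conv insertI1 less_irrefl)
    obtain y where y: "y \<in> {1..n}" "T - {C} = star_family n r y" using star[OF C(1)] by blast
    have "A \<in> star_family n r y" "A \<notin> star_family n r x" using A C x(2) y(2) by blast+
    then have "x \<noteq> y" by auto
    have "star_family n r x \<subseteq> insert C (star_family n r x \<inter> star_family n r y)"
      using x(2) y(2) by blast
    then have "card (star_family n r x) \<le> card (insert C (star_family n r x \<inter> star_family n r y))"
      by (intro card_mono) auto
    also have "\<dots> \<le> Suc (card (star_family n r x \<inter> star_family n r y))"
      by (simp add: card_insert_if)
    also have "\<dots> = Suc D" using x y \<open>x \<noteq> y\<close> r by (simp add: card_star_Int D_def)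
    finally have ND: "N \<le> Suc D" using x by (simp add: cst)
    \<comment> \<open>Multiplying \<open>N \<le> D + 1\<close> by \<open>n - 1\<close> and using
      \<open>n - 1 \<le> N\<close> yields \<open>(n - 1) * N \<le> r * N\<close>, which
      \<open>r + 2 \<le> n\<close> excludes.\<close>
    have "(n - 1) * D = (r - 1) * N"
      using r by (intro codegree_eq[of r n]) (auto simp: N_def D_def)
    moreover have "n - 1 \<le> N"
      using r by (intro star_size_ge[of r n]) (auto simp: N_def)
    moreover have "(n - 1) * N \<le> (n - 1) * D + (n - 1)"
      using mult_le_mono2[OF ND, of "n - 1"] by simp
    ultimately have "(n - 1) * N \<le> (r - 1) * N + 1 * N" by linarith
    moreover have "(r - 1) * N + 1 * N = r * N" using r by (cases r) auto
    ultimately have "(n - 1) * N \<le> r * N" by linarith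
    then show False using Npos r by simp
  qed
qed

lemma eventually_cube_le:
  fixes r :: "nat \<Rightarrow> nat" and \<delta> :: real
  assumes "(\<lambda>n. real (r n)) \<in> o(\<lambda>n. real n powr (1 / 3))" "0 < \<delta>"
  shows "\<forall>\<^sub>F n in sequentially. real (r n) ^ 3 \<le> \<delta> * n"
proof -
  have "0 < \<delta> powr (1 / 3)" using assms by simp
  from landau_o.smallD[OF assms(1) this]
  have "\<forall>\<^sub>F n in sequentially. real (r n) \<le> \<delta> powr (1 / 3) * real n powr (1 / 3)" by simp
  then show ?thesis
  proof eventually_elim
    case (elim n)
    have "real (r n) ^ 3 \<le> (\<delta> powr (1 / 3) * real n powr (1 / 3)) ^ 3"
      using elim by (intro power_mono) auto
    also have "\<dots> = \<delta> * n"
    proof -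
      have "(x powr (1 / 3)) ^ 3 = x" if "0 \<le> x" for x :: real
        using powr_numeral[of "x powr (1 / 3)" "Num.Bit1 Num.One"] that by (simp add: powr_powr)
      then show ?thesis using assms(2) by (simp add: power_mult_distrib)
    qed
    finally show ?case .
  qed
qed

text \<open>From \<open>r \<ge> 2\<close> follows \<open>4 * r \<le> r ^ 3\<close>. The linear bound
  supplies side conditions such as \<open>r < n\<close>, \<open>2 * r \<le> n\<close> and
  \<open>r + 2 \<le> n\<close>.\<close>

lemma eventually_cube_le_nat:
  fixes r :: "nat \<Rightarrow> nat"
  assumes "(\<lambda>n. real (r n)) \<in> o(\<lambda>n. real n powr (1 / 3))" "\<And>n. 2 \<le> r n"
  shows "\<forall>\<^sub>F n in sequentially. r n ^ 3 \<le> n \<and> 4 * r n \<le> n"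
  using eventually_cube_le[OF assms(1) zero_less_one]
proof eventually_elim
  case (elim n)
  then have "real (r n ^ 3) \<le> real n" by simp
  then have c: "r n ^ 3 \<le> n" by (simp only: of_nat_le_iff)
  have "2 * 2 \<le> r n * r n" using assms(2)[of n] by (intro mult_le_mono)
  then have "4 * r n \<le> r n * r n * r n" by (intro mult_le_mono) auto
  then show ?case using c unfolding power3_eq_cube by linarith
qed

lemma prob_nonstar_indep_tendsto_0:
  fixes \<epsilon> :: real and r :: "nat \<Rightarrow> nat" and p :: "nat \<Rightarrow> real"
  assumes \<epsilon>: "\<epsilon> > 0" and r: "\<And>n. 2 \<le> r n"
    and o: "(\<lambda>n. real (r n)) \<in> o(\<lambda>n. real n powr (1 / 3))"
    and p: "\<And>n. 0 \<le> p n \<and> p n \<le> 1"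
    and pc: "\<forall>\<^sub>F n in sequentially. p n \<ge> (1 + \<epsilon>) * p_crit n (r n)"
  shows "(\<lambda>n. measure_pmf.prob (random_kneser_edges n (r n) (p n))
      {E. \<exists>\<S>. independent_in (kneser_verts n (r n)) E \<S> \<and> card \<S> = (n - 1) choose (r n - 1) \<and>
        (\<forall>x\<in>{1..n}. \<S> \<noteq> star_family n (r n) x)}) \<longlonglongrightarrow> 0"
proof -
  define \<eta> where "\<eta> = \<epsilon> / (6 * (1 + \<epsilon>))"
  define t where "t n = \<epsilon> / 3 * ln (real n)" for n :: nat
  define N where "N n = (n - 1) choose (r n - 1)" for n
  have \<eta>: "0 < \<eta>" using \<epsilon> by (simp add: \<eta>_def)
  have tlim: "filterlim t at_top sequentially" unfolding t_def using \<epsilon> by real_asymp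
  have elim0: "(\<lambda>n. exp (- t n)) \<longlonglongrightarrow> 0" unfolding t_def using \<epsilon> by real_asymp
  \<comment> \<open>These are the thresholds for \<open>small1\<close> and \<open>small2\<close>;
    \<open>exp (- 3)\<close> leaves \<open>exp (- 1)\<close> after multiplication by
    \<open>exp 2\<close>.\<close>
  have s1: "\<forall>\<^sub>F n in sequentially. exp (- t n) < \<eta> / 2" "\<forall>\<^sub>F n in sequentially. exp (- t n) < \<eta>\<^sup>2 * exp (- 3)"
    using \<eta> by (simp_all only: order_tendstoD(2)[OF elim0] mult_pos_pos zero_less_power exp_gt_zero half_gt_zero)
  have s3: "\<forall>\<^sub>F n in sequentially. 1 \<le> t n"
    using tlim by (simp add: filterlim_at_top)
  \<comment> \<open>19 exceeds twice 9, so that \<open>9 * n / 19\<close> is below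
    \<open>n - 1\<close>, as the strict bound on the codegree requires.\<close>
  have cube: "\<forall>\<^sub>F n in sequentially. real (r n) ^ 3 \<le> \<eta> ^ 3 / 19 * n"
    using o \<eta> by (intro eventually_cube_le) auto
  have Nge: "\<forall>\<^sub>F n in sequentially. real n - 1 \<le> real (N n)"
    using eventually_cube_le_nat[OF o r]
  proof eventually_elim
    case (elim n)
    have "n - 1 \<le> N n" using elim r[of n] by (intro star_size_ge[of "r n" n]) (auto simp: N_def)
    then show ?case by linarith
  qed
  have Nlim: "filterlim (\<lambda>n. real (N n)) at_top sequentially"
  proof (rule filterlim_at_top_mono[OF _ Nge])
    show "filterlim (\<lambda>n. real n - 1) at_top sequentially" by real_asymp
  qed
  have "((\<lambda>x::real. (x + 1)\<^sup>2 * exp (- \<eta> * x)) \<longlongrightarrow> 0) at_top" using \<eta> by real_asymp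
  then have Nlim0: "(\<lambda>n. (real (N n) + 1)\<^sup>2 * exp (- \<eta> * N n)) \<longlonglongrightarrow> 0"
    by (rule filterlim_compose[OF _ Nlim])
  show ?thesis
  proof (rule tendsto_sandwich[of "\<lambda>_. 0"])
    show "\<forall>\<^sub>F n in sequentially. measure_pmf.prob (random_kneser_edges n (r n) (p n))
      {E. \<exists>\<S>. independent_in (kneser_verts n (r n)) E \<S> \<and> card \<S> = (n - 1) choose (r n - 1) \<and>
        (\<forall>x\<in>{1..n}. \<S> \<noteq> star_family n (r n) x)}
      \<le> 2 / \<eta> * exp (- t n) + (real (N n) + 1)\<^sup>2 * exp (- \<eta> * N n) + exp 1 * exp (- t n)"
      using pc eventually_cube_le_nat[OF o r] s1 s3 cube
    proof eventually_elim
      case (elim n)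
      define D where "D = (n - 2) choose (r n - 2)"
      have r': "2 \<le> r n" "r n < n" using r[of n] elim by auto
      have ND: "(n - 1) * D = (r n - 1) * N n"
        using elim r' by (intro codegree_eq[of "r n" n]) (auto simp: N_def D_def)
      have Npos: "0 < N n" using r' by (simp add: N_def)
      \<comment> \<open>The codegree bound is proved after multiplication by \<open>n - 1\<close>,
        where \<open>codegree_eq\<close> trades \<open>D\<close> for \<open>N\<close> at the price
        of one more factor \<open>r\<close>.\<close>
      have "real (n - 1) * (9 * (real (r n))\<^sup>2 * D) = 9 * (real (r n))\<^sup>2 * (real (r n - 1) * N n)"
        using arg_cong[OF ND, of real] by (simp add: mult_ac)
      also have "\<dots> \<le> 9 * (real (r n))\<^sup>2 * (real (r n) * N n)"
        by (intro mult_left_mono mult_right_mono) auto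
      also have "\<dots> = 9 * real (r n) ^ 3 * N n" by (simp add: power2_eq_square power3_eq_cube)
      also have "\<dots> \<le> 9 * (\<eta> ^ 3 / 19 * n) * N n"
        using elim by (intro mult_left_mono mult_right_mono) auto
      also have "\<dots> < real (n - 1) * (\<eta> ^ 3 * N n)"
      proof -
        have "9 * real n / 19 < real (n - 1)" using r' by (simp add: of_nat_diff)
        then have "9 * real n / 19 * (\<eta> ^ 3 * N n) < real (n - 1) * (\<eta> ^ 3 * N n)"
          using \<eta> Npos by (intro mult_strict_right_mono) auto
        then show ?thesis by (simp add: mult_ac)
      qed
      finally have DN: "9 * (real (r n))\<^sup>2 * D < \<eta> ^ 3 * N n"
        using r' by (simp only: mult_less_cancel_left_pos of_nat_0_less_iff zero_less_diff)
      show ?case unfolding N_def[symmetric]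
      proof (rule prob_nonstar_indep_small[where \<epsilon> = \<epsilon> and D = D and V = "n choose r n"])
        show "exp (- t n) / \<eta> \<le> 1 / 2" using elim \<eta> by (simp add: field_simps)
        have "exp 2 / \<eta>\<^sup>2 * exp (- t n) \<le> exp 2 / \<eta>\<^sup>2 * (\<eta>\<^sup>2 * exp (- 3))"
          using elim by (intro mult_left_mono) auto
        also have "\<dots> = exp (- 1)" using \<eta> by (simp flip: exp_add)
        finally show "exp 2 / \<eta>\<^sup>2 * exp (- t n) \<le> exp (- 1)" .
      qed (use elim r' \<epsilon> p[of n] DN in \<open>simp_all add: \<eta>_def t_def N_def D_def\<close>)
    qed
    show "(\<lambda>n. 2 / \<eta> * exp (- t n) + (real (N n) + 1)\<^sup>2 * exp (- \<eta> * N n) + exp 1 * exp (- t n)) \<longlonglongrightarrow> 0"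
      by (rule tendsto_eq_intros elim0 Nlim0 | simp)+
  qed simp_all
qed

lemma prob_independence_number_star_tendsto_0:
  fixes \<epsilon> :: real and r :: "nat \<Rightarrow> nat" and p :: "nat \<Rightarrow> real"
  assumes \<epsilon>: "\<epsilon> > 0" "\<epsilon> < 1" and r: "\<And>n. 2 \<le> r n"
    and o: "(\<lambda>n. real (r n)) \<in> o(\<lambda>n. real n powr (1 / 3))"
    and p: "\<And>n. 0 \<le> p n \<and> p n \<le> 1"
    and pc: "\<forall>\<^sub>F n in sequentially. p n \<le> (1 - \<epsilon>) * p_crit n (r n)"
  shows "(\<lambda>n. measure_pmf.prob (random_kneser_edges n (r n) (p n))
      {E. independence_number (kneser_verts n (r n)) E = (n - 1) choose (r n - 1)}) \<longlonglongrightarrow> 0"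
proof -
  define s where "s n = 2 / 3 * \<epsilon>\<^sup>2 * ln (real n)" for n :: nat
  have slim: "filterlim s at_top sequentially" unfolding s_def using \<epsilon> by real_asymp
  have slim0: "(\<lambda>n. exp (- s n)) \<longlonglongrightarrow> 0" unfolding s_def using \<epsilon> by real_asymp
  have s3: "\<forall>\<^sub>F n in sequentially. 1 \<le> s n"
    using slim by (simp add: filterlim_at_top)
  \<comment> \<open>Bounding the arbitrary \<open>r\<close> by the cube root of \<open>n\<close>
    leaves explicit functions for the asymptotics.\<close>
  define c where "c n = real n powr (1 / 3)" for n :: nat
  have rc: "\<forall>\<^sub>F n in sequentially. real (r n) \<le> c n"
    using landau_o.smallD[OF o, of 1] by (simp add: c_def)
  have a1: "\<forall>\<^sub>F n in sequentially. (c n + 1) * ln n \<le> \<epsilon> / 2 * (real n - 1)"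
    unfolding c_def using \<epsilon> by real_asymp
  have a2: "\<forall>\<^sub>F n in sequentially. c n * (c n + 1) * ln n \<le> real n - 1"
    unfolding c_def by real_asymp
  have clim: "(\<lambda>n. c n / real n) \<longlonglongrightarrow> 0" unfolding c_def by real_asymp
  show ?thesis
  proof (rule tendsto_sandwich[of "\<lambda>_. 0"])
    show "\<forall>\<^sub>F n in sequentially. measure_pmf.prob (random_kneser_edges n (r n) (p n))
      {E. independence_number (kneser_verts n (r n)) E = (n - 1) choose (r n - 1)}
      \<le> 3 * exp (- s n) + exp 2 * (2 * (c n / real n))"
      using pc eventually_cube_le_nat[OF o r] s3 rc a1 a2
    proof eventually_elim
      case (elim n)
      have r': "2 \<le> r n" "r n < n" using r[of n] elim by auto
      have ln0: "0 \<le> ln (real n)" and n1: "real (n - 1) = real n - 1"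
        using r' by (simp_all add: of_nat_diff)
      have "measure_pmf.prob (random_kneser_edges n (r n) (p n))
          {E. independence_number (kneser_verts n (r n)) E = (n - 1) choose (r n - 1)}
        \<le> 3 * exp (- s n) + exp 2 * (2 * real (r n) / n)"
      proof (rule prob_independence_number_star_small[where \<epsilon> = \<epsilon> and D = "(n - 2) choose (r n - 2)"
            and V = "n choose r n"])
        have "(real (r n) + 1) * ln n \<le> (c n + 1) * ln n"
          using elim ln0 by (intro mult_right_mono) auto
        then show "(real (r n) + 1) * ln n \<le> \<epsilon> / 2 * real (n - 1)"
          unfolding n1 using elim by linarith
        have "real (r n) * (real (r n) + 1) * ln n \<le> c n * (c n + 1) * ln n"
          using elim ln0 by (intro mult_right_mono mult_mono) auto
        then show "real (r n) * (real (r n) + 1) * ln n \<le> real (n - 1)"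
          unfolding n1 using elim by linarith
      qed (use elim r' \<epsilon> p[of n] in \<open>simp_all add: s_def\<close>)
      also have "\<dots> \<le> 3 * exp (- s n) + exp 2 * (2 * (c n / real n))"
        using elim by (simp add: divide_right_mono)
      finally show ?case .
    qed
    show "(\<lambda>n. 3 * exp (- s n) + exp 2 * (2 * (c n / real n))) \<longlonglongrightarrow> 0"
      by (rule tendsto_eq_intros slim0 clim | simp)+
  qed simp_all
qed

theorem theorem1p2:
  fixes \<epsilon> :: real and r :: "nat \<Rightarrow> nat" and p :: "nat \<Rightarrow> real"
  assumes "\<epsilon> > 0"
    and "\<And>n. 2 \<le> r n"
    and "(\<lambda>n. real (r n)) \<in> o(\<lambda>n. real n powr (1 / 3))"
    and "\<And>n. 0 \<le> p n \<and> p n \<le> 1"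
  shows
    "((\<forall>\<^sub>F n in sequentially. p n \<ge> (1 + \<epsilon>) * p_crit n (r n)) \<longrightarrow>
        (\<lambda>n. measure_pmf.prob (random_kneser_edges n (r n) (p n))
               {E. independence_number (kneser_verts n (r n)) E = (n - 1) choose (r n - 1)})
          \<longlonglongrightarrow> 1) \<and>
     ((\<forall>\<^sub>F n in sequentially. p n \<le> (1 - \<epsilon>) * p_crit n (r n)) \<longrightarrow>
        (\<lambda>n. measure_pmf.prob (random_kneser_edges n (r n) (p n))
               {E. independence_number (kneser_verts n (r n)) E = (n - 1) choose (r n - 1)})
          \<longlonglongrightarrow> 0) \<and>
     ((\<forall>\<^sub>F n in sequentially. p n \<ge> (1 + \<epsilon>) * p_crit n (r n)) \<longrightarrow>
        (\<lambda>n. measure_pmf.prob (random_kneser_edges n (r n) (p n))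
               {E. \<forall>S. independent_in (kneser_verts n (r n)) E S \<and>
                       card S = (n - 1) choose (r n - 1) \<longrightarrow>
                       (\<exists>x\<in>{1..n}. S = star_family n (r n) x)})
          \<longlonglongrightarrow> 1)"
proof (intro conjI impI)
  let ?bad = "\<lambda>n. {E. \<exists>\<S>. independent_in (kneser_verts n (r n)) E \<S> \<and>
      card \<S> = (n - 1) choose (r n - 1) \<and> (\<forall>x\<in>{1..n}. \<S> \<noteq> star_family n (r n) x)}"
  let ?P = "\<lambda>n. measure_pmf.prob (random_kneser_edges n (r n) (p n))"
  let ?stars = "\<lambda>n. {E. \<forall>S. independent_in (kneser_verts n (r n)) E S \<and>
      card S = (n - 1) choose (r n - 1) \<longrightarrow> (\<exists>x\<in>{1..n}. S = star_family n (r n) x)}"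
  assume "\<forall>\<^sub>F n in sequentially. p n \<ge> (1 + \<epsilon>) * p_crit n (r n)"
  then have "(\<lambda>n. ?P n (?bad n)) \<longlonglongrightarrow> 0"
    using assms by (intro prob_nonstar_indep_tendsto_0)
  then have "(\<lambda>n. 1 - ?P n (?bad n)) \<longlonglongrightarrow> 1 - 0" by (intro tendsto_intros)
  moreover have "1 - ?P n (?bad n) = ?P n (?stars n)" for n
  proof -
    have "?stars n = UNIV - ?bad n" by auto
    then show ?thesis using measure_pmf.prob_compl[of "?bad n"] by simp
  qed
  ultimately show stars: "(\<lambda>n. ?P n (?stars n)) \<longlonglongrightarrow> 1" by simp
  \<comment> \<open>The first claim follows from the last: if only stars are independent at this
    size, the independence number is that of a star.\<close>
  show "(\<lambda>n. ?P n {E. independence_number (kneser_verts n (r n)) E = (n - 1) choose (r n - 1)}) \<longlonglongrightarrow> 1"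
  proof (rule tendsto_sandwich[OF _ _ stars])
    show "\<forall>\<^sub>F n in sequentially. ?P n (?stars n) \<le>
        ?P n {E. independence_number (kneser_verts n (r n)) E = (n - 1) choose (r n - 1)}"
      using eventually_cube_le_nat[OF assms(3,2)]
    proof eventually_elim
      case (elim n)
      show ?case
      proof (rule prob_random_kneser_mono)
        fix E assume "E \<subseteq> kneser_edges n (r n)" "E \<in> ?stars n"
        then show "E \<in> {E. independence_number (kneser_verts n (r n)) E = (n - 1) choose (r n - 1)}"
          using elim assms(2)[of n] independence_number_eq_if_only_stars[of "r n" n E] by auto
      qed
    qed
  qed (auto intro: tendsto_const)
next
  \<comment> \<open>The second moment bound needs \<open>\<epsilon> < 1\<close>. Lowering
    \<open>\<epsilon>\<close> weakens the assumption on \<open>p\<close>, because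
    \<open>p_crit\<close> is eventually nonnegative.\<close>
  define \<epsilon>' where "\<epsilon>' = min \<epsilon> (1 / 2)"
  assume "\<forall>\<^sub>F n in sequentially. p n \<le> (1 - \<epsilon>) * p_crit n (r n)"
  then have "\<forall>\<^sub>F n in sequentially. p n \<le> (1 - \<epsilon>') * p_crit n (r n)"
    using eventually_cube_le_nat[OF assms(3,2)]
  proof eventually_elim
    case (elim n)
    have "0 \<le> 2 / 3 * (real (r n) + 1) * ln n" using elim assms(2)[of n] by simp
    also have "\<dots> \<le> crit_log n (r n)" using elim assms(2)[of n] by (intro crit_log_ge) auto
    finally have "0 \<le> p_crit n (r n)" by (simp add: p_crit_eq)
    then have "(1 - \<epsilon>) * p_crit n (r n) \<le> (1 - \<epsilon>') * p_crit n (r n)"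
      by (intro mult_right_mono) (auto simp: \<epsilon>'_def)
    then show ?case using elim by simp
  qed
  then show "(\<lambda>n. measure_pmf.prob (random_kneser_edges n (r n) (p n))
      {E. independence_number (kneser_verts n (r n)) E = (n - 1) choose (r n - 1)}) \<longlonglongrightarrow> 0"
    using assms by (intro prob_independence_number_star_tendsto_0[where \<epsilon> = \<epsilon>']) (auto simp: \<epsilon>'_def)
qed

end
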